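(* Under the sphere assumption, a sequence $y\in\mathcal H$ has a representing measure on $K$ if and only if $M_d(g_iy)\succeq0$ for all $i=0,\dots,m$ and all $d\in\mathbb N$.
   Context: Complex setting: $n,m\in\mathbb N^*$, $z^\alpha=z_1^{\alpha_1}\cdots z_n^{\alpha_n}$, $|\alpha|=\sum\alpha_i$. $g_1,\dots,g_m$ are real-valued complex polynomials $g_i(z)=\sum_{|\gamma|,|\delta|\le k_i}g_{i,\gamma,\delta}\bar z^\gamma z^\delta$ with $\overline{g_{i,\gamma,\delta}}=g_{i,\delta,\gamma}$; $g_0:=1$; $K=\{z\in\mathbb C^n:g_i(z)\ge0,\ i=1,\dots,m\}$. $\mathcal H$ is the set of complex families $y=(y_{\alpha,\beta})_{\alpha,\beta\in\mathbb N^n}$ with $\overline{y_{\alpha,\beta}}=y_{\beta,\alpha}$. $M_d(g_iy)$ is the Hermitian matrix indexed by $|\alpha|,|\beta|\le d$ with entries $\sum_{|\gamma|,|\delta|\le k_i}g_{i,\gamma,\delta}y_{\alpha+\gamma,\beta+\delta}$. $y$ has a representing measure $\mu$ on $K$ if $\mu$ is a positive Radon measure on $K$ and $y_{\alpha,\beta}=\int_K\bar z^\alpha z^\beta\,d\mu$ for all $\alpha,\beta$. Sphere assumption: for some $R>0$ the constraints include $R^2-\sum_{j}|z_j|^2\ge0$ and $-(R^2-\sum_j|z_j|^2)\ge0$. *)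

theory Defs
  imports "HOL-Analysis.Analysis"
begin

definition mi_deg :: "('n::finite \<Rightarrow> nat) \<Rightarrow> nat" where
  "mi_deg \<alpha> = (\<Sum>j\<in>UNIV. \<alpha> j)"

definition midx :: "nat \<Rightarrow> ('n::finite \<Rightarrow> nat) set" where
  "midx d = {\<alpha>. mi_deg \<alpha> \<le> d}"

definition mi_add :: "('n \<Rightarrow> nat) \<Rightarrow> ('n \<Rightarrow> nat) \<Rightarrow> ('n \<Rightarrow> nat)" where
  "mi_add \<alpha> \<gamma> = (\<lambda>j. \<alpha> j + \<gamma> j)"

definition cmono :: "complex ^ 'n::finite \<Rightarrow> ('n \<Rightarrow> nat) \<Rightarrow> complex" where
  "cmono z \<alpha> = (\<Prod>j\<in>UNIV. (z $ j) ^ (\<alpha> j))"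

definition hpoly :: "(('n::finite \<Rightarrow> nat) \<Rightarrow> ('n \<Rightarrow> nat) \<Rightarrow> complex) \<Rightarrow> nat \<Rightarrow> complex ^ 'n \<Rightarrow> complex" where
  "hpoly c k z = (\<Sum>\<gamma>\<in>midx k. \<Sum>\<delta>\<in>midx k. c \<gamma> \<delta> * cnj (cmono z \<gamma>) * cmono z \<delta>)"

definition locmat :: "(('n::finite \<Rightarrow> nat) \<Rightarrow> ('n \<Rightarrow> nat) \<Rightarrow> complex) \<Rightarrow> nat
     \<Rightarrow> (('n \<Rightarrow> nat) \<Rightarrow> ('n \<Rightarrow> nat) \<Rightarrow> complex) \<Rightarrow> ('n \<Rightarrow> nat) \<Rightarrow> ('n \<Rightarrow> nat) \<Rightarrow> complex" where
  "locmat c k y \<alpha> \<beta> = (\<Sum>\<gamma>\<in>midx k. \<Sum>\<delta>\<in>midx k. c \<gamma> \<delta> * y (mi_add \<alpha> \<gamma>) (mi_add \<beta> \<delta>))"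

definition psd_on :: "nat \<Rightarrow> (('n::finite \<Rightarrow> nat) \<Rightarrow> ('n \<Rightarrow> nat) \<Rightarrow> complex) \<Rightarrow> bool" where
  "psd_on d M \<longleftrightarrow> (\<forall>v :: ('n \<Rightarrow> nat) \<Rightarrow> complex.
      let q = (\<Sum>\<alpha>\<in>midx d. \<Sum>\<beta>\<in>midx d. cnj (v \<alpha>) * M \<alpha> \<beta> * v \<beta>)
      in Im q = 0 \<and> 0 \<le> Re q)"

text \<open>Coefficients of R^2 - sum_j |z_j|^2 = R^2 - sum_j conj(z_j) z_j.\<close>
definition sphere_coeff :: "real \<Rightarrow> ('n \<Rightarrow> nat) \<Rightarrow> ('n \<Rightarrow> nat) \<Rightarrow> complex" where
  "sphere_coeff R \<gamma> \<delta> =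
     (if \<gamma> = (\<lambda>_. 0) \<and> \<delta> = (\<lambda>_. 0) then complex_of_real (R\<^sup>2)
      else if \<gamma> = \<delta> \<and> (\<exists>j. \<gamma> = (\<lambda>l. if l = j then 1 else 0)) then -1
      else 0)"

text \<open>y has a representing measure mu on K: mu a finite (hence Radon, K compact) positive
  Borel measure on complex^'n concentrated on K, with y_{alpha,beta} = int conj(z)^alpha z^beta dmu.\<close>
definition has_rep_measure :: "(complex ^ 'n::finite) set \<Rightarrow> (('n \<Rightarrow> nat) \<Rightarrow> ('n \<Rightarrow> nat) \<Rightarrow> complex) \<Rightarrow> bool" where
  "has_rep_measure K y \<longleftrightarrow> (\<exists>\<mu> :: (complex ^ 'n) measure.
      sets \<mu> = sets borel \<and> finite_measure \<mu> \<and> emeasure \<mu> (UNIV - K) = 0 \<and>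
      (\<forall>\<alpha> \<beta>. integrable \<mu> (\<lambda>z. cnj (cmono z \<alpha>) * cmono z \<beta>) \<and>
              y \<alpha> \<beta> = (\<integral>z. cnj (cmono z \<alpha>) * cmono z \<beta> \<partial>\<mu>)))"

end

(* On the sphere the functions R +- Re z_j and R +- Im z_j are, up to a positive factor, sums of
   squared moduli of polynomials in z: for instance
   2R (R - Re z_j) = |R - z_j|^2 + (sum of |z_i|^2 over i distinct from j). The cone of sums of
   squared moduli is closed under multiplication, so a Hermitian y with positive semidefinite moment
   matrix that vanishes on the sphere ideal is nonnegative on all Bernstein products in the rescaled
   real coordinates. Hence y solves a multidimensional Hausdorff moment problem on a cube. The same
   holds for each localized sequence g_i y, and comparing the two representing measures shows that
   g_i is nonnegative almost everywhere. *)

theory Submission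
  imports Defs "HOL-Probability.Helly_Selection" "HOL-Computational_Algebra.Polynomial"
begin

section \<open>A space-filling curve\<close>

text \<open>Positive semidefinite moment matrices only test |p(z)|^2 with p a polynomial in z alone,
  whereas a positive functional on R^(2n) has to be tested on far more functions. Without the sphere
  relation this gap is real: a positive diagonal kernel whose diagonal is not log-convex has no
  representing measure. On the sphere the gap closes because a coordinate x = (1 + Re z_j / R) / 2
  and its complement 1 - x both lie in the cone, so multiplying the moments by either one keeps
  positivity and the sphere relation. Iterating this gives the sign conditions of complete
  monotonicity. The cube is larger than the sphere, so the measure obtained is at first known only
  to have bounded support; the two sphere constraints are then treated like every other g_i when the
  support is located. The limit of discrete measures on the cube is taken with a selection theorem
  for the real line, hence the curve built first.\<close>

definition sch_step :: "real \<Rightarrow> real" where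
  "sch_step t = max 0 (min 1 (1/2 - cos (pi * t)))"

lemma sch_step_bounds: "0 \<le> sch_step t" "sch_step t \<le> 1"
  by (auto simp: sch_step_def)

lemma continuous_on_sch_step: "continuous_on S sch_step"
  unfolding sch_step_def by (intro continuous_intros)

text \<open>A clipped cosine plays the part of Schoenberg's piecewise linear auxiliary function: it
  is continuous, has period 2, vanishes on [0, 1/3] and equals 1 on [2/3, 1]. The period removes
  \<open>2 * q\<close>, and the remaining argument lies in the first interval if b = 0 and in the
  second if b = 1.\<close>

lemma sch_step_digit:
  fixes b q r :: real
  assumes "b \<in> {0, 1}" "q \<in> \<int>" "0 \<le> r" "r \<le> 1/3"
  shows "sch_step (2 * q + 2 * b / 3 + r) = b"
proof -
  define x where "x = 2 * b / 3 + r"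
  have "cos (pi * (2 * q + x)) = cos (pi * x + 2 * pi * q)"
    by (simp add: algebra_simps)
  also have "\<dots> = cos (pi * x)"
    using assms(2) by (simp add: cos_add sin_integer_2pi cos_integer_2pi)
  finally have eq: "cos (pi * (2 * q + x)) = cos (pi * x)" .
  have "sch_step (2 * q + x) = b"
  proof (cases "b = 0")
    case True
    have "cos (pi / 3) \<le> cos (pi * x)"
      using assms True by (intro cos_monotone_0_pi_le) (auto simp: x_def field_simps)
    with True show ?thesis by (simp add: sch_step_def eq cos_60)
  next
    case False
    hence b: "b = 1" using assms by auto
    have "cos (pi * x) \<le> cos (pi - pi / 3)"
    proof (intro cos_monotone_0_pi_le)
      show "0 \<le> pi - pi / 3" by (simp add: field_simps)
      have "pi * x \<le> pi * 1" using assms b by (intro mult_left_mono) (simp_all add: x_def)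
      thus "pi * x \<le> pi" by simp
      have "pi * (2 / 3) \<le> pi * x" using assms b by (intro mult_left_mono) (simp_all add: x_def)
      thus "pi - pi / 3 \<le> pi * x" by simp
    qed
    also have "\<dots> = - 1/2" by (simp add: cos_120)
    finally show ?thesis by (simp add: sch_step_def eq b)
  qed
  thus ?thesis by (simp add: x_def add.assoc)
qed

text \<open>A Cantor set point has ternary digits 0 and 2 only. Multiplication by 3^n therefore
  moves an even integer, a multiple of the period of \<open>sch_step\<close>, in front of the
  ternary point; the next digit selects the third, and the tail is at most 1/3.\<close>

lemma ternary_digit_sums:
  fixes b :: "nat \<Rightarrow> real"
  assumes b: "\<And>m. b m \<in> {0, 1}"
  defines "t \<equiv> (\<Sum>m. 2 * b m / 3 ^ Suc m)"
  shows "0 \<le> t" "t \<le> 1" "sch_step (3 ^ n * t) = b n"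
proof -
  have bb: "0 \<le> b m" "b m \<le> 1" for m using b[of m] by auto
  have geo: "(\<lambda>m. 2 / 3 ^ Suc (m + k)) sums (1 / 3 ^ k :: real)" for k :: nat
  proof -
    have "(\<lambda>m. (2 / 3 ^ Suc k) * (1/3) ^ m) sums ((2 / 3 ^ Suc k) * (1 / (1 - 1/3 :: real)))"
      by (intro sums_mult geometric_sums) simp
    thus ?thesis by (simp add: power_add field_simps)
  qed
  have summ: "summable (\<lambda>m. 2 * b (m + k) / 3 ^ Suc (m + k))" for k
    using bb by (intro summable_comparison_test'[OF sums_summable[OF geo[of k]]])
                (auto simp: divide_simps)
  have tail_nn: "0 \<le> (\<Sum>m. 2 * b (m + k) / 3 ^ Suc (m + k))" for k
    using bb by (intro suminf_nonneg summ) auto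
  have tail_le: "(\<Sum>m. 2 * b (m + k) / 3 ^ Suc (m + k)) \<le> 1 / 3 ^ k" for k
  proof -
    have "(\<Sum>m. 2 * b (m + k) / 3 ^ Suc (m + k)) \<le> (\<Sum>m. 2 / 3 ^ Suc (m + k))"
      using bb by (intro suminf_le summ sums_summable[OF geo]) (auto simp: divide_simps)
    thus ?thesis using sums_unique[OF geo[of k]] by simp
  qed
  show "0 \<le> t" "t \<le> 1" using tail_nn[of 0] tail_le[of 0] by (auto simp: t_def)
  define q where "q = (\<Sum>m<n. b m * 3 ^ (n - Suc m))"
  define r where "r = 3 ^ n * (\<Sum>m. 2 * b (m + Suc n) / 3 ^ Suc (m + Suc n))"
  have "t = (\<Sum>m. 2 * b (m + Suc n) / 3 ^ Suc (m + Suc n)) + (\<Sum>m<Suc n. 2 * b m / 3 ^ Suc m)"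
    unfolding t_def by (rule suminf_split_initial_segment) (use summ[of 0] in simp)
  hence "3 ^ n * t = r + 3 ^ n * (\<Sum>m<n. 2 * b m / 3 ^ Suc m) + 2 * b n / 3"
    by (simp add: r_def algebra_simps)
  also have "3 ^ n * (\<Sum>m<n. 2 * b m / 3 ^ Suc m) = 2 * q"
    unfolding q_def sum_distrib_left
  proof (intro sum.cong refl)
    fix m assume "m \<in> {..<n}"
    hence "(3::real) ^ n = 3 ^ (n - Suc m) * 3 ^ Suc m"
      by (simp only: power_add[symmetric]) simp
    thus "3 ^ n * (2 * b m / 3 ^ Suc m) = 2 * (b m * 3 ^ (n - Suc m))" by simp
  qed
  finally have "3 ^ n * t = 2 * q + 2 * b n / 3 + r" by simp
  moreover have "q \<in> \<int>"
    unfolding q_def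
  proof (intro Ints_sum Ints_mult Ints_power)
    show "b m \<in> \<int>" for m using b[of m] by auto
  qed simp_all
  moreover have "0 \<le> r" unfolding r_def by (intro mult_nonneg_nonneg tail_nn) simp
  moreover have "r \<le> 1/3"
    unfolding r_def using mult_left_mono[OF tail_le[of "Suc n"], of "3 ^ n"] by simp
  ultimately show "sch_step (3 ^ n * t) = b n" using sch_step_digit[OF b] by simp
qed

lemma binary_digits:
  fixes u :: real
  assumes "0 \<le> u" "u \<le> 1"
  obtains a :: "nat \<Rightarrow> real" where "\<And>n. a n \<in> {0, 1}" "(\<lambda>n. a n / 2 ^ n) sums u"
proof -
  \<comment> \<open>\<open>f (Suc n)\<close> truncates u after n binary places and
    \<open>f 0 = 0\<close>, so the digits are scaled increments and their series telescopes. The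
    digit of index 0 has weight 1, which accommodates u = 1.\<close>
  define f :: "nat \<Rightarrow> real" where "f n = (if n = 0 then 0 else \<lfloor>2 ^ (n - 1) * u\<rfloor> / 2 ^ (n - 1))" for n
  define a where "a n = 2 ^ n * (f (Suc n) - f n)" for n
  have "a n \<in> {0, 1}" for n
  proof (cases n)
    case 0
    have "\<lfloor>u\<rfloor> = 0 \<or> \<lfloor>u\<rfloor> = 1" using assms by linarith
    thus ?thesis using 0 by (auto simp: a_def f_def)
  next
    case (Suc k)
    have "\<lfloor>2 * (2 ^ k * u)\<rfloor> = 2 * \<lfloor>2 ^ k * u\<rfloor> \<or> \<lfloor>2 * (2 ^ k * u)\<rfloor> = 2 * \<lfloor>2 ^ k * u\<rfloor> + 1"
      by linarith
    thus ?thesis using Suc by (auto simp: a_def f_def field_simps)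
  qed
  moreover have "f \<longlonglongrightarrow> u"
  proof (rule LIMSEQ_imp_Suc, rule tendsto_sandwich)
    show "\<forall>\<^sub>F n in sequentially. u - (1/2) ^ n \<le> f (Suc n)"
    proof (rule always_eventually, rule allI)
      fix n
      have "2 ^ n * u - 1 \<le> of_int \<lfloor>2 ^ n * u\<rfloor>" by linarith
      hence "(2 ^ n * u - 1) / 2 ^ n \<le> of_int \<lfloor>2 ^ n * u\<rfloor> / 2 ^ n"
        by (intro divide_right_mono) auto
      thus "u - (1/2) ^ n \<le> f (Suc n)" by (simp add: f_def diff_divide_distrib power_one_over)
    qed
    show "\<forall>\<^sub>F n in sequentially. f (Suc n) \<le> u"
    proof (rule always_eventually, rule allI)
      fix n
      have "of_int \<lfloor>2 ^ n * u\<rfloor> \<le> 2 ^ n * u" by linarith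
      thus "f (Suc n) \<le> u" by (simp add: f_def field_simps)
    qed
    have "(\<lambda>n. u - (1/2) ^ n) \<longlonglongrightarrow> u - 0"
      by (intro tendsto_intros) auto
    thus "(\<lambda>n. u - (1/2) ^ n) \<longlonglongrightarrow> u" by simp
  qed auto
  hence "(\<lambda>n. f (Suc n) - f n) sums (u - f 0)" by (rule telescope_sums)
  hence "(\<lambda>n. a n / 2 ^ n) sums u" by (simp add: a_def f_def)
  ultimately show ?thesis using that by blast
qed

text \<open>Schoenberg's curve: the ternary digits of the parameter encode the interleaved binary digits
  of the coordinates.\<close>

lemma space_filling_curve:
  obtains f :: "real \<Rightarrow> real ^ 'i::finite"
  where "continuous_on UNIV f" "\<And>t i. 0 \<le> f t $ i" "\<And>t i. f t $ i \<le> 1"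
    "\<And>x. (\<And>i. 0 \<le> x $ i \<and> x $ i \<le> 1) \<Longrightarrow> \<exists>t\<in>{0..1}. f t = x"
proof -
  obtain ix :: "'i \<Rightarrow> nat" where ix: "bij_betw ix UNIV {0..<CARD('i)}"
    using ex_bij_betw_finite_nat[of "UNIV :: 'i set"] by auto
  define N where "N = CARD('i)"
  have ixN: "ix i < N" for i using ix by (auto simp: bij_betw_def N_def)
  \<comment> \<open>Coordinate i reads the digits at the positions congruent to \<open>ix i\<close>
    modulo \<open>N\<close>. The weights 1, 1/2, 1/4, ... add up to 2, hence the cut at 1 in
    \<open>f\<close>; it does not alter values that encode points of the cube.\<close>
  define h where "h i t = (\<Sum>n. sch_step (3 ^ (N * n + ix i) * t) / 2 ^ n)" for i t
  define f :: "real \<Rightarrow> real ^ 'i" where "f t = (\<chi> i. min 1 (h i t))" for t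
  have geo: "summable (\<lambda>n. (1/2::real) ^ n)" by (simp add: summable_geometric)
  have summ: "summable (\<lambda>n. sch_step (3 ^ (N * n + ix i) * t) / 2 ^ n)" for i t
    using sch_step_bounds
    by (intro summable_comparison_test'[OF geo, of 0]) (auto simp: divide_simps)
  have unif: "uniform_limit UNIV (\<lambda>k t. \<Sum>n<k. sch_step (3 ^ (N * n + ix i) * t) / 2 ^ n) (h i) sequentially" for i
    unfolding h_def[abs_def]
    using sch_step_bounds by (intro Weierstrass_m_test[OF _ geo]) (auto simp: divide_simps)
  have "continuous_on UNIV (h i)" for i
    by (rule uniform_limit_theorem[OF _ unif])
       (auto intro!: always_eventually continuous_intros
          continuous_on_compose2[OF continuous_on_sch_step[of UNIV]])
  hence "continuous_on UNIV f"
    unfolding f_def by (intro continuous_on_vec_lambda continuous_on_min continuous_on_const)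
  moreover have "0 \<le> f t $ i" "f t $ i \<le> 1" for t i
    using sch_step_bounds by (auto simp: f_def h_def intro!: suminf_nonneg summ)
  moreover have "\<exists>t\<in>{0..1}. f t = x" if x: "\<And>i. 0 \<le> x $ i \<and> x $ i \<le> 1" for x
  proof -
    have "\<exists>a :: nat \<Rightarrow> real. (\<forall>n. a n \<in> {0, 1}) \<and> (\<lambda>n. a n / 2 ^ n) sums (x $ i)" for i
      using binary_digits[of "x $ i"] x[of i] by metis
    then obtain a :: "'i \<Rightarrow> nat \<Rightarrow> real"
      where a: "\<And>i n. a i n \<in> {0, 1}" "\<And>i. (\<lambda>n. a i n / 2 ^ n) sums (x $ i)" by metis
    define b where "b m = a (inv_into UNIV ix (m mod N)) (m div N)" for m
    have b: "b m \<in> {0, 1}" for m using a(1) by (simp add: b_def)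
    have bN: "b (N * n + ix i) = a i n" for n i
      using ixN[of i] bij_betw_inv_into_left[OF ix, of i] by (simp add: b_def)
    define t where "t = (\<Sum>m. 2 * b m / 3 ^ Suc m)"
    have "h i t = x $ i" for i
      using ternary_digit_sums(3)[of b, OF b, folded t_def] a(2)[of i]
      by (simp add: h_def bN sums_iff)
    hence "f t = x" using x by (simp add: f_def vec_eq_iff)
    moreover have "t \<in> {0..1}" using ternary_digit_sums(1,2)[of b, OF b] by (simp add: t_def)
    ultimately show ?thesis by blast
  qed
  ultimately show ?thesis using that by blast
qed

section \<open>The Hausdorff moment problem on a cube\<close>

definition binc :: "'i \<Rightarrow> ('i \<Rightarrow> nat) \<Rightarrow> 'i \<Rightarrow> nat" where
  "binc i a = a(i := Suc (a i))"

lemma finite_box: "finite {b :: 'i::finite \<Rightarrow> nat. \<forall>i. b i \<le> M}"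
proof -
  have "{b :: 'i \<Rightarrow> nat. \<forall>i. b i \<le> M} = PiE UNIV (\<lambda>_. {..M})" by (auto simp: PiE_UNIV_domain)
  thus ?thesis by (simp add: finite_PiE)
qed

lemma prod_sum_box:
  fixes f :: "'i::finite \<Rightarrow> nat \<Rightarrow> real"
  shows "(\<Sum>b | \<forall>i. b i \<le> M. \<Prod>i\<in>UNIV. f i (b i)) = (\<Prod>i\<in>UNIV. \<Sum>n\<le>M. f i n)"
  by (subst prod_sum_PiE) (auto simp: PiE_UNIV_domain intro!: sum.cong)

text \<open>The linear functional x^b -> \<open>s b\<close>, applied to the product of the
  one-variable polynomials \<open>p i\<close> in the variables x_i. It is the full functional as
  long as all degrees are at most \<open>M\<close>.\<close>

definition box_functional :: "nat \<Rightarrow> (('i::finite \<Rightarrow> nat) \<Rightarrow> real) \<Rightarrow> ('i \<Rightarrow> real poly) \<Rightarrow> real" where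
  "box_functional M s p = (\<Sum>b | \<forall>i. b i \<le> M. (\<Prod>i\<in>UNIV. coeff (p i) (b i)) * s b)"

lemma prod_UNIV_remove: "(\<Prod>j\<in>UNIV. h j) = h i * (\<Prod>j\<in>UNIV - {i}. h j)"
  for h :: "'i::finite \<Rightarrow> real"
  by (rule prod.remove) auto

text \<open>Multiplication by x_i becomes a shift of the sequence. The strict degree bound ensures
  that no monomial leaves the box: the terms with exponent \<open>M\<close> in direction i have
  coefficient 0 before the shift.\<close>

lemma box_functional_pCons:
  assumes "degree q < M"
  shows "box_functional M s (p(i := pCons 0 q)) = box_functional M (\<lambda>a. s (binc i a)) (p(i := q))"
proof -
  let ?F = "\<lambda>b. (\<Prod>j\<in>UNIV. coeff ((p(i := pCons 0 q)) j) (b j)) * s b"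
  let ?G = "\<lambda>b. (\<Prod>j\<in>UNIV. coeff ((p(i := q)) j) (b j)) * s (binc i b)"
  have "(\<Sum>b | \<forall>i. b i \<le> M. ?F b) = (\<Sum>b | (\<forall>i. b i \<le> M) \<and> b i \<noteq> 0. ?F b)"
    by (intro sum.mono_neutral_right finite_box) (auto simp: prod_UNIV_remove[of _ i] intro!: gr0I)
  also have "\<dots> = (\<Sum>b | (\<forall>i. b i \<le> M) \<and> b i \<noteq> M. ?G b)"
  proof (intro sum.reindex_bij_witness[where i = "binc i" and j = "\<lambda>b. b(i := b i - 1)"])
    fix b assume b: "b \<in> {b. (\<forall>i. b i \<le> M) \<and> b i \<noteq> 0}"
    thus *: "binc i (b(i := b i - 1)) = b" by (auto simp: binc_def)
    have "b i - 1 < M" using b by (simp add: less_le_trans[of _ "b i"])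
    thus "b(i := b i - 1) \<in> {b. (\<forall>i. b i \<le> M) \<and> b i \<noteq> M}" using b by simp
    obtain n where n: "b i = Suc n" using b by (cases "b i") auto
    show "?G (b(i := b i - 1)) = ?F b"
      by (subst *, simp add: prod_UNIV_remove[of _ i] n)
  next
    fix b assume b: "b \<in> {b. (\<forall>i. b i \<le> M) \<and> b i \<noteq> M}"
    thus "(binc i b)(i := binc i b i - 1) = b" by (auto simp: binc_def)
    have "b i < M" using b by (auto intro: le_neq_implies_less)
    thus "binc i b \<in> {b. (\<forall>i. b i \<le> M) \<and> b i \<noteq> 0}" using b by (auto simp: binc_def)
  qed
  also have "\<dots> = (\<Sum>b | \<forall>i. b i \<le> M. ?G b)"
    using assms
    by (intro sum.mono_neutral_left finite_box) (auto simp: prod_UNIV_remove[of _ i] coeff_eq_0)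
  finally show ?thesis by (simp only: box_functional_def)
qed

lemma box_functional_diff_poly:
  "box_functional M s (p(i := q - r)) = box_functional M s (p(i := q)) - box_functional M s (p(i := r))"
  by (simp add: box_functional_def prod_UNIV_remove[of _ i] sum_subtractf algebra_simps)

lemma box_functional_diff:
  "box_functional M (\<lambda>a. s a - t a) p = box_functional M s p - box_functional M t p"
  by (simp add: box_functional_def sum_subtractf algebra_simps)

section \<open>Positivity on Bernstein products\<close>

definition bern_factor :: "nat \<Rightarrow> nat \<Rightarrow> real poly" where
  "bern_factor k l = [:0, 1:] ^ k * [:1, -1:] ^ l"

lemma degree_bern_factor: "degree (bern_factor k l) = k + l"
  unfolding bern_factor_def by (subst degree_mult_eq) (auto simp: degree_power_eq)

lemma box_functional_bern_Suc1:
  assumes "k + l < M"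
  shows "box_functional M s (p(i := bern_factor (Suc k) l)) =
         box_functional M (\<lambda>a. s (binc i a)) (p(i := bern_factor k l))"
proof -
  have "bern_factor (Suc k) l = pCons 0 (bern_factor k l)" by (simp add: bern_factor_def)
  thus ?thesis using box_functional_pCons[of "bern_factor k l" M] assms by (simp add: degree_bern_factor)
qed

lemma box_functional_bern_Suc2:
  assumes "k + l < M"
  shows "box_functional M s (p(i := bern_factor k (Suc l))) =
         box_functional M (\<lambda>a. s a - s (binc i a)) (p(i := bern_factor k l))"
proof -
  have "bern_factor k (Suc l) = bern_factor k l - pCons 0 (bern_factor k l)"
    by (simp add: bern_factor_def algebra_simps)
  thus ?thesis using box_functional_pCons[of "bern_factor k l" M] assms
    by (simp add: degree_bern_factor box_functional_diff_poly box_functional_diff)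
qed

text \<open>Removing a factor x_i or 1 - x_i replaces s by a shift or a difference, which stays in
  \<open>Q\<close>; once all factors are gone, only the value at 0 remains. An abstract closed class
  \<open>Q\<close> thus stands in for explicit iterated differences, and the induction must range
  over all its members.\<close>

lemma box_functional_bern_nonneg:
  fixes k l :: "'i::finite \<Rightarrow> nat"
  assumes Q0: "\<And>t. t \<in> Q \<Longrightarrow> 0 \<le> t (\<lambda>_. 0)"
    and Q1: "\<And>t i. t \<in> Q \<Longrightarrow> (\<lambda>a. t (binc i a)) \<in> Q"
    and Q2: "\<And>t i. t \<in> Q \<Longrightarrow> (\<lambda>a. t a - t (binc i a)) \<in> Q"
    and "s \<in> Q" and "\<And>i. k i + l i \<le> M"
  shows "0 \<le> box_functional M s (\<lambda>i. bern_factor (k i) (l i))"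
  using assms(4,5)
proof (induction "\<Sum>i\<in>UNIV. k i + l i" arbitrary: s k l)
  case 0
  hence kl: "k i = 0 \<and> l i = 0" for i by simp
  have "box_functional M s (\<lambda>i. bern_factor (k i) (l i)) = s (\<lambda>_. 0)"
  proof -
    have "(\<Prod>i\<in>UNIV. coeff 1 (b i)) * s b = (if b = (\<lambda>_. 0) then s b else 0)" for b :: "'i \<Rightarrow> nat"
      by (auto simp: fun_eq_iff coeff_1)
    thus ?thesis by (simp add: box_functional_def kl bern_factor_def finite_box)
  qed
  thus ?case using Q0 0 by simp
next
  case (Suc n)
  have "\<exists>i. k i + l i \<noteq> 0"
  proof (rule ccontr)
    assume "\<not> ?thesis"
    hence "(\<Sum>i\<in>UNIV. k i + l i) = 0" by simp
    thus False using Suc(2) by simp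
  qed
  then obtain i where i: "k i + l i \<noteq> 0" by blast
  have decr: "n = (\<Sum>j\<in>UNIV. (k(i := k')) j + (l(i := l')) j)" if "k i + l i = Suc (k' + l')" for k' l'
  proof -
    have "(\<Sum>j\<in>UNIV. (k(i := k')) j + (l(i := l')) j) = k' + l' + (\<Sum>j\<in>UNIV - {i}. k j + l j)"
      by (subst sum.remove[of _ i]) auto
    moreover have "Suc n = k i + l i + (\<Sum>j\<in>UNIV - {i}. k j + l j)"
      by (subst Suc(2), subst sum.remove[of _ i]) auto
    ultimately show ?thesis using that by simp
  qed
  have upd: "(\<lambda>j. bern_factor ((k(i := k')) j) ((l(i := l')) j)) =
             (\<lambda>j. bern_factor (k j) (l j))(i := bern_factor k' l')" for k' l'
    by auto
  show ?case
  proof (cases "k i")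
    case (Suc k')
    have M: "k' + l i < M" using Suc.prems(2)[of i] Suc by simp
    have "box_functional M s (\<lambda>j. bern_factor (k j) (l j)) =
          box_functional M s ((\<lambda>j. bern_factor (k j) (l j))(i := bern_factor (Suc k') (l i)))"
      using Suc by (intro arg_cong[where f = "box_functional M s"]) auto
    also have "\<dots> = box_functional M (\<lambda>a. s (binc i a)) (\<lambda>j. bern_factor ((k(i := k')) j) ((l(i := l i)) j))"
      by (subst upd) (rule box_functional_bern_Suc1[OF M])
    also have "\<dots> \<ge> 0"
      using Suc.prems(2) M Suc by (intro Suc.hyps(1) decr Q1 Suc.prems(1)) auto
    finally show ?thesis .
  next
    case 0
    then obtain l' where l': "l i = Suc l'" using i by (cases "l i") auto
    have M: "k i + l' < M" using Suc.prems(2)[of i] l' by simp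
    have "box_functional M s (\<lambda>j. bern_factor (k j) (l j)) =
          box_functional M s ((\<lambda>j. bern_factor (k j) (l j))(i := bern_factor (k i) (Suc l')))"
      using l' by (intro arg_cong[where f = "box_functional M s"]) auto
    also have "\<dots> = box_functional M (\<lambda>a. s a - s (binc i a)) (\<lambda>j. bern_factor ((k(i := k i)) j) ((l(i := l')) j))"
      by (subst upd) (rule box_functional_bern_Suc2[OF M])
    also have "\<dots> \<ge> 0"
      using Suc.prems(2) M l' by (intro Suc.hyps(1) decr Q2 Suc.prems(1)) auto
    finally show ?thesis .
  qed
qed

section \<open>Bernstein weights with exact factorial moments\<close>

text \<open>With the ratio of binomials in place of (k/N)^a the Bernstein sum reproduces x^a without
  error: C(N,k) C(k,a) = C(N,a) C(N-a,k-a), after which x^a factors out and the rest is (x + (1 -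
  x))^(N-a).\<close>

lemma bernstein_binomial_moment:
  assumes "a \<le> N"
  shows "(\<Sum>k\<le>N. smult (real (k choose a) / real (N choose a) * real (N choose k)) (bern_factor k (N - k)))
           = [:0, 1:] ^ a"
proof -
  have "(\<Sum>k\<le>N. smult (real (k choose a) / real (N choose a) * real (N choose k)) (bern_factor k (N - k)))
      = (\<Sum>k\<in>{a..N}. smult (real (k choose a) / real (N choose a) * real (N choose k)) (bern_factor k (N - k)))"
    by (intro sum.mono_neutral_right) auto
  also have "\<dots> = (\<Sum>k\<in>{a..N}. smult (real ((N - a) choose (k - a))) (bern_factor k (N - k)))"
  proof (intro sum.cong refl)
    fix k assume k: "k \<in> {a..N}"
    have "real (N choose k) * real (k choose a) = real (N choose a) * real ((N - a) choose (k - a))"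
      using choose_mult[of a k N] k by (simp flip: of_nat_mult)
    moreover have "real (N choose a) \<noteq> 0" using assms by simp
    ultimately have "real (k choose a) / real (N choose a) * real (N choose k) = real ((N - a) choose (k - a))"
      by (simp add: field_simps)
    thus "smult (real (k choose a) / real (N choose a) * real (N choose k)) (bern_factor k (N - k)) =
          smult (real ((N - a) choose (k - a))) (bern_factor k (N - k))" by simp
  qed
  also have "\<dots> = (\<Sum>j\<le>N - a. smult (real ((N - a) choose j)) (bern_factor (j + a) (N - (j + a))))"
    using assms by (intro sum.reindex_bij_witness[where i = "\<lambda>j. j + a" and j = "\<lambda>k. k - a"]) auto
  also have "\<dots> = [:0, 1:] ^ a * (\<Sum>j\<le>N - a. of_nat ((N - a) choose j) * [:0, 1:] ^ j * [:1, -1:] ^ (N - a - j))"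
    unfolding sum_distrib_left
  proof (intro sum.cong refl)
    fix j assume "j \<in> {..N - a}"
    hence "N - (j + a) = N - a - j" by simp
    thus "smult (real ((N - a) choose j)) (bern_factor (j + a) (N - (j + a))) =
      [:0, 1:] ^ a * (of_nat ((N - a) choose j) * [:0, 1:] ^ j * [:1, -1:] ^ (N - a - j))"
      by (simp only: bern_factor_def power_add of_nat_poly mult_ac) (simp add: mult_ac)
  qed
  also have "(\<Sum>j\<le>N - a. of_nat ((N - a) choose j) * [:0, 1:] ^ j * [:1, -1:] ^ (N - a - j)) =
    ([:0, 1:] + [:1, -1 :: real:]) ^ (N - a)"
    by (rule binomial_ring[symmetric])
  also have "[:0, 1:] + [:1, -1 :: real:] = 1" by (simp add: one_pCons)
  finally show ?thesis by simp
qed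

text \<open>The functional defined by s is evaluated at the Bernstein basis polynomials of degree
  \<open>N\<close> in each variable. Their nonnegativity gives the sign of the weights, and the
  exact one-variable identity, multiplied over the coordinates, gives the factorial moments.\<close>

lemma bernstein_weights:
  fixes s :: "('i::finite \<Rightarrow> nat) \<Rightarrow> real"
  assumes Q0: "\<And>t. t \<in> Q \<Longrightarrow> 0 \<le> t (\<lambda>_. 0)"
    and Q1: "\<And>t i. t \<in> Q \<Longrightarrow> (\<lambda>a. t (binc i a)) \<in> Q"
    and Q2: "\<And>t i. t \<in> Q \<Longrightarrow> (\<lambda>a. t a - t (binc i a)) \<in> Q"
    and s: "s \<in> Q"
  obtains w :: "('i \<Rightarrow> nat) \<Rightarrow> real" where "\<And>\<nu>. 0 \<le> w \<nu>"
    "\<And>a. (\<And>i. a i \<le> N) \<Longrightarrow>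
      (\<Sum>\<nu> | \<forall>i. \<nu> i \<le> N. w \<nu> * (\<Prod>i\<in>UNIV. real (\<nu> i choose a i) / real (N choose a i))) = s a"
proof
  define w where "w \<nu> = (if \<forall>i. \<nu> i \<le> N then (\<Prod>i\<in>UNIV. real (N choose \<nu> i)) *
      box_functional N s (\<lambda>i. bern_factor (\<nu> i) (N - \<nu> i)) else 0)" for \<nu> :: "'i \<Rightarrow> nat"
  have "0 \<le> box_functional N s (\<lambda>i. bern_factor (\<nu> i) (N - \<nu> i))" if "\<forall>i. \<nu> i \<le> N" for \<nu>
    by (rule box_functional_bern_nonneg[where Q = Q]) (use Q0 Q1 Q2 s that in auto)
  thus "0 \<le> w \<nu>" for \<nu>
    by (auto simp: w_def intro!: mult_nonneg_nonneg prod_nonneg)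
  fix a :: "'i \<Rightarrow> nat" assume a: "\<And>i. a i \<le> N"
  define c where "c i k = real (k choose a i) / real (N choose a i)" for i k
  have "(\<Sum>\<nu> | \<forall>i. \<nu> i \<le> N. w \<nu> * (\<Prod>i\<in>UNIV. c i (\<nu> i))) =
    (\<Sum>\<nu> | \<forall>i. \<nu> i \<le> N. \<Sum>b | \<forall>i. b i \<le> N. s b *
       (\<Prod>i\<in>UNIV. c i (\<nu> i) * real (N choose \<nu> i) * coeff (bern_factor (\<nu> i) (N - \<nu> i)) (b i)))"
    by (intro sum.cong refl)
       (simp add: w_def box_functional_def prod.distrib sum_distrib_left sum_distrib_right mult_ac)
  also have "\<dots> = (\<Sum>b | \<forall>i. b i \<le> N. s b * (\<Prod>i\<in>UNIV. \<Sum>k\<le>N.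
       c i k * real (N choose k) * coeff (bern_factor k (N - k)) (b i)))"
    by (subst sum.swap) (simp add: prod_sum_box[symmetric] sum_distrib_left)
  also have "\<dots> = (\<Sum>b | \<forall>i. b i \<le> N. if b = a then s b else 0)"
  proof (intro sum.cong refl)
    fix b :: "'i \<Rightarrow> nat"
    \<comment> \<open>The inner sum is the coefficient of x^(b i) in x^(a i), so the product over i
      is the Kronecker delta of a and b.\<close>
    have "(\<Sum>k\<le>N. c i k * real (N choose k) * coeff (bern_factor k (N - k)) (b i)) =
          coeff ([:0, 1:] ^ a i) (b i)" for i
      by (subst bernstein_binomial_moment[OF a, of i, symmetric]) (simp add: coeff_sum c_def)
    also have "coeff ([:0, 1 :: real:] ^ a i) (b i) = (if b i = a i then 1 else 0)" for i
      by (simp flip: monom_altdef[of 1, simplified])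
    finally have *: "(\<Sum>k\<le>N. c i k * real (N choose k) * coeff (bern_factor k (N - k)) (b i)) =
       (if b i = a i then 1 else 0)" for i .
    show "s b * (\<Prod>i\<in>UNIV. \<Sum>k\<le>N. c i k * real (N choose k) * coeff (bern_factor k (N - k)) (b i)) =
      (if b = a then s b else 0)"
      unfolding * by (auto simp: fun_eq_iff)
  qed
  also have "\<dots> = s a" using a by (simp add: finite_box)
  finally show "(\<Sum>\<nu> | \<forall>i. \<nu> i \<le> N. w \<nu> * (\<Prod>i\<in>UNIV. real (\<nu> i choose a i) / real (N choose a i))) = s a"
    by (simp add: c_def)
qed

section \<open>Factorial moments against power moments\<close>

lemma binomial_ratio_prod:
  assumes "a \<le> N" "k \<le> N"
  shows "real (k choose a) / real (N choose a) = (\<Prod>l<a. real (k - l) / real (N - l))"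
proof (cases "a \<le> k")
  case True
  have *: "real (m choose a) = (\<Prod>l<a. real (m - l) / real (a - l))" if "a \<le> m" for m
    unfolding binomial_gbinomial gbinomial_altdef_of_nat atLeast0LessThan
    using that by (intro prod.cong) (auto simp: of_nat_diff)
  have "real (k choose a) / real (N choose a) =
        (\<Prod>l<a. (real (k - l) / real (a - l)) / (real (N - l) / real (a - l)))"
    using True assms by (simp only: * prod_dividef)
  also have "\<dots> = (\<Prod>l<a. real (k - l) / real (N - l))"
    by (intro prod.cong) auto
  finally show ?thesis .
next
  case False
  hence "real (k choose a) = 0" "(\<Prod>l<a. real (k - l) / real (N - l)) = 0"
    by (auto intro!: prod_zero bexI[of _ k])
  thus ?thesis by (simp only: div_0)
qed

text \<open>Both quantities are products of \<open>a\<close> factors in [0, 1], so their distance is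
  at most the sum of the distances of the factors. For l at most k the l-th distance is (l/N)
  (N-k)/(N-l); for l > k truncated subtraction leaves k/N. Either way it is at most a/N.\<close>

lemma binomial_ratio_approx:
  assumes "a \<le> N" "k \<le> N" "0 < N"
  shows "\<bar>real (k choose a) / real (N choose a) - (real k / real N) ^ a\<bar> \<le> real a ^ 2 / real N"
proof -
  have bound: "\<bar>real (k - l) / real (N - l) - real k / real N\<bar> \<le> real a / real N" if l: "l < a" for l
  proof (cases "l \<le> k")
    case True
    have N: "0 < real N" "0 < real (N - l)" using l assms by auto
    define X where "X = (real l / real N) * (real (N - k) / real (N - l))"
    have eq: "real k / real N - real (k - l) / real (N - l) = X" unfolding X_def
      using N True assms l by (simp add: of_nat_diff field_simps)
    have "real (N - k) / real (N - l) \<le> 1" using True assms N by (simp add: field_simps)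
    hence "X \<le> (real a / real N) * 1"
      unfolding X_def using l N by (intro mult_mono divide_right_mono) auto
    moreover have "0 \<le> X" by (simp add: X_def)
    ultimately show ?thesis
      by (subst abs_minus_commute) (simp only: eq abs_of_nonneg mult_1_right)
  next
    case False
    thus ?thesis using l by (auto intro: divide_right_mono)
  qed
  have "norm ((\<Prod>l<a. real (k - l) / real (N - l)) - (\<Prod>l<a. real k / real N)) \<le>
        (\<Sum>l<a. norm (real (k - l) / real (N - l) - real k / real N))"
    using assms by (intro norm_prod_diff) (auto simp: divide_simps)
  also have "\<dots> \<le> (\<Sum>l<a. real a / real N)"
    using bound by (intro sum_mono) auto
  finally show ?thesis
    by (simp add: binomial_ratio_prod[OF assms(1,2)] power2_eq_square)
qed

lemma multi_binomial_ratio_approx: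
  fixes a \<nu> :: "'i::finite \<Rightarrow> nat"
  assumes "\<And>i. a i \<le> N" "\<And>i. \<nu> i \<le> N" "0 < N"
  shows "\<bar>(\<Prod>i\<in>UNIV. (real (\<nu> i) / real N) ^ a i) -
          (\<Prod>i\<in>UNIV. real (\<nu> i choose a i) / real (N choose a i))\<bar> \<le> (\<Sum>i\<in>UNIV. real (a i) ^ 2) / real N"
proof -
  have le1: "real (\<nu> i choose a i) / real (N choose a i) \<le> 1" for i
    using assms(1,2)[of i] by (subst binomial_ratio_prod) (auto intro!: prod_le_1 simp: divide_simps)
  have "norm ((\<Prod>i\<in>UNIV. (real (\<nu> i) / real N) ^ a i) -
          (\<Prod>i\<in>UNIV. real (\<nu> i choose a i) / real (N choose a i))) \<le>
        (\<Sum>i\<in>UNIV. norm ((real (\<nu> i) / real N) ^ a i - real (\<nu> i choose a i) / real (N choose a i)))"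
    using assms le1 by (intro norm_prod_diff) (auto intro!: power_le_one simp: power_le_one)
  also have "\<dots> \<le> (\<Sum>i\<in>UNIV. real (a i) ^ 2 / real N)"
    using binomial_ratio_approx assms by (intro sum_mono) (auto simp: abs_minus_commute)
  finally show ?thesis by (simp add: sum_divide_distrib)
qed

text \<open>The closure conditions on Q say that s is completely monotone. The atomic measures given by the
  Bernstein weights are pulled back to the real line along a space-filling curve, so that
  Helly's one-dimensional selection theorem provides their weak limit.\<close>

lemma hausdorff_moment_problem:
  fixes s :: "('i::finite \<Rightarrow> nat) \<Rightarrow> real"
  assumes Q0: "\<And>t. t \<in> Q \<Longrightarrow> 0 \<le> t (\<lambda>_. 0)"
    and Q1: "\<And>t i. t \<in> Q \<Longrightarrow> (\<lambda>a. t (binc i a)) \<in> Q"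
    and Q2: "\<And>t i. t \<in> Q \<Longrightarrow> (\<lambda>a. t a - t (binc i a)) \<in> Q"
    and s: "s \<in> Q"
  obtains \<mu> :: "(real ^ 'i) measure" where "sets \<mu> = sets borel" "finite_measure \<mu>"
    "AE x in \<mu>. \<forall>i. 0 \<le> x $ i \<and> x $ i \<le> 1"
    "\<And>a. (\<integral>x. (\<Prod>i\<in>UNIV. x $ i ^ a i) \<partial>\<mu>) = s a"
proof -
  define W where "W N w \<longleftrightarrow> (\<forall>\<nu>. 0 \<le> w \<nu>) \<and> (\<forall>a. (\<forall>i. a i \<le> N) \<longrightarrow>
      (\<Sum>\<nu> | \<forall>i. \<nu> i \<le> N. w \<nu> * (\<Prod>i\<in>UNIV. real (\<nu> i choose a i) / real (N choose a i))) = s a)"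
    for N and w :: "('i \<Rightarrow> nat) \<Rightarrow> real"
  have "\<exists>w. W N w" for N
    unfolding W_def
    by (rule bernstein_weights[of Q s N], fact Q0, fact Q1, fact Q2, fact s) blast
  then obtain w where "\<And>N. W N (w N)" by metis
  hence w: "\<And>N \<nu>. 0 \<le> w N \<nu>" and
    ws: "\<And>N a. (\<And>i. a i \<le> N) \<Longrightarrow>
      (\<Sum>\<nu> | \<forall>i. \<nu> i \<le> N. w N \<nu> * (\<Prod>i\<in>UNIV. real (\<nu> i choose a i) / real (N choose a i))) = s a"
    by (simp_all add: W_def)
  define S :: "nat \<Rightarrow> ('i \<Rightarrow> nat) set" where "S N = {\<nu>. \<forall>i. \<nu> i \<le> N}" for N
  have finS: "finite (S N)" for N by (simp add: S_def finite_box)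
  define s0 where "s0 = s (\<lambda>_. 0)"
  have wsum: "(\<Sum>\<nu>\<in>S N. w N \<nu>) = s0" for N
    using ws[of "\<lambda>_. 0" N] by (simp add: s0_def S_def)
  show ?thesis
  \<comment> \<open>The selection theorem concerns probability distributions, so the weights are
    divided by their total mass \<open>s0\<close>. Mass 0 is treated apart: all weights vanish,
    hence so does s.\<close>
  proof (cases "s0 = 0")
    case True
    have "s a = 0" for a
    proof -
      define N where "N = Max (range a)"
      have aN: "a i \<le> N" for i by (simp add: N_def)
      have "\<forall>\<nu>\<in>S N. w N \<nu> = 0"
        using wsum[of N] True w finS by (simp add: sum_nonneg_eq_0_iff)
      thus ?thesis using ws[of a N, OF aN] by (simp add: S_def)
    qed
    thus ?thesis
      by (intro that[of "null_measure borel"]) (auto intro!: finite_measureI AE_I[of _ _ UNIV])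
  next
    case False
    moreover have "0 \<le> s0" using Q0[OF s] by (simp add: s0_def)
    ultimately have s0: "0 < s0" by simp
    obtain f :: "real \<Rightarrow> real ^ 'i" where f: "continuous_on UNIV f" "\<And>t i. 0 \<le> f t $ i" "\<And>t i. f t $ i \<le> 1"
      "\<And>x. (\<And>i. 0 \<le> x $ i \<and> x $ i \<le> 1) \<Longrightarrow> \<exists>t\<in>{0..1}. f t = x"
      using space_filling_curve by blast
    have "\<exists>t\<in>{0..1}. f t = (\<chi> i. real (\<nu> i) / real N)" if "\<nu> \<in> S N" for N \<nu>
      using that by (intro f(4)) (auto simp: S_def divide_simps)
    hence ex: "\<exists>t. t \<in> {0..1} \<and> f t = (\<chi> i. real (\<nu> i) / real N)" if "\<nu> \<in> S N" for N \<nu>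
      using that by blast
    \<comment> \<open>A parameter at which the curve passes through the grid point \<nu>/N; the
      atoms are placed at these parameters.\<close>
    define \<tau> where "\<tau> N \<nu> = (SOME t. t \<in> {0..1} \<and> f t = (\<chi> i. real (\<nu> i) / real N))" for N \<nu>
    have \<tau>: "\<tau> N \<nu> \<in> {0..1}" "f (\<tau> N \<nu>) = (\<chi> i. real (\<nu> i) / real N)" if "\<nu> \<in> S N" for N \<nu>
      using someI_ex[OF ex[OF that]] by (simp_all add: \<tau>_def)
    define P where "P N = point_measure (S N) (\<lambda>\<nu>. w N \<nu> / s0)" for N
    define \<rho> where "\<rho> N = distr (P N) borel (\<tau> N)" for N
    have prob: "prob_space (P N)" for N
    proof
      have "emeasure (P N) (S N) = (\<Sum>\<nu>\<in>S N. ennreal (w N \<nu> / s0))"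
        unfolding P_def by (rule emeasure_point_measure_finite[OF finS]) simp
      also have "\<dots> = 1"
        using w s0 by (subst sum_ennreal) (auto simp: sum_divide_distrib[symmetric] wsum)
      finally show "emeasure (P N) (space (P N)) = 1" by (simp add: P_def space_point_measure)
    qed
    have rd: "real_distribution (\<rho> N)" for N
      unfolding \<rho>_def by (rule prob_space.real_distribution_distr[OF prob]) (simp add: P_def)
    have int: "integral\<^sup>L (\<rho> N) h = (\<Sum>\<nu>\<in>S N. w N \<nu> / s0 * h (\<tau> N \<nu>))"
      if "h \<in> borel_measurable borel" for N and h :: "real \<Rightarrow> real"
      unfolding \<rho>_def P_def using that w s0 finS
      by (subst integral_distr) (auto simp: lebesgue_integral_point_measure_finite)
    have "tight \<rho>"
      unfolding tight_def
    proof (intro conjI allI impI rd)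
      fix e :: real assume e: "0 < e"
      \<comment> \<open>Tightness is phrased with intervals open on the left. The left end -1 keeps
        a possible atom at the parameter 0.\<close>
      have "measure (\<rho> N) {-1<..1} = 1" for N
      proof -
        interpret real_distribution "\<rho> N" by (rule rd)
        have "AE t in \<rho> N. t \<in> {-1<..1}"
          unfolding \<rho>_def
        proof (subst AE_distr_iff)
          show "AE \<nu> in P N. \<tau> N \<nu> \<in> {-1<..1}"
          proof (rule AE_I2)
            fix \<nu> assume "\<nu> \<in> space (P N)"
            hence "\<nu> \<in> S N" by (simp add: P_def space_point_measure)
            from \<tau>(1)[OF this] show "\<tau> N \<nu> \<in> {-1<..1}" by simp
          qed
        qed (simp_all add: P_def)
        thus ?thesis by (simp add: prob_eq_1)
      qed
      thus "\<exists>a b. a < b \<and> (\<forall>n. 1 - e < measure (\<rho> n) {a<..b})"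
        using e by (intro exI[of _ "-1"] exI[of _ 1]) auto
    qed
    from tight_imp_convergent_subsubsequence[OF this strict_mono_id]
    obtain r M where r: "strict_mono (r :: nat \<Rightarrow> nat)" and M: "real_distribution M"
      and wc: "weak_conv_m (\<rho> \<circ> r) M" by auto
    interpret M: real_distribution M by (rule M)
    have fm[measurable]: "f \<in> borel_measurable borel"
      using f(1) by (rule borel_measurable_continuous_onI)
    have moment: "(\<integral>t. (\<Prod>i\<in>UNIV. f t $ i ^ a i) \<partial>M) = s a / s0" for a
    proof -
      define F where "F t = (\<Prod>i\<in>UNIV. f t $ i ^ a i)" for t
      have Fc: "continuous_on UNIV F" unfolding F_def by (intro continuous_intros f(1))
      have Fm[measurable]: "F \<in> borel_measurable borel" by (rule borel_measurable_continuous_onI[OF Fc])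
      have F1: "\<bar>F t\<bar> \<le> 1" for t
        unfolding F_def abs_prod using f(2,3) by (intro prod_le_1) (auto intro!: power_le_one)
      have lim1: "(\<lambda>n. integral\<^sup>L (\<rho> (r n)) F) \<longlonglongrightarrow> integral\<^sup>L M F"
        using weak_conv_imp_integral_bdd_continuous_conv[of "\<rho> \<circ> r" M F 1] rd M wc F1 Fc
        by (simp add: continuous_on_eq_continuous_at)
      have "(\<lambda>N. integral\<^sup>L (\<rho> N) F) \<longlonglongrightarrow> s a / s0"
      \<comment> \<open>The factorial moments of the weights equal \<open>s a\<close> exactly once
        \<open>N\<close> dominates every exponent; replacing them by power moments costs
        O(1/N).\<close>
      proof (rule LIM_zero_cancel, rule tendsto_0_le)
        show "(\<lambda>N. 1 / real N) \<longlonglongrightarrow> 0" by (rule lim_1_over_n)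
        have "eventually (\<lambda>N. N > 0 \<and> N \<ge> Max (range a)) sequentially"
          by (intro eventually_conj eventually_gt_at_top eventually_ge_at_top)
        thus "\<forall>\<^sub>F N in sequentially. norm (integral\<^sup>L (\<rho> N) F - s a / s0) \<le> norm (1 / real N) * (\<Sum>i\<in>UNIV. real (a i) ^ 2)"
        proof eventually_elim
          case (elim N)
          hence aN: "a i \<le> N" for i by (meson Max_ge finite finite_imageI le_trans rangeI)
          define G where "G \<nu> = (\<Prod>i\<in>UNIV. real (\<nu> i choose a i) / real (N choose a i))" for \<nu> :: "'i \<Rightarrow> nat"
          let ?K = "(\<Sum>i\<in>UNIV. real (a i) ^ 2) / real N"
          have sa: "s a / s0 = (\<Sum>\<nu>\<in>S N. w N \<nu> / s0 * G \<nu>)"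
            using ws[of a N, OF aN] by (simp add: S_def G_def flip: sum_divide_distrib)
          have "integral\<^sup>L (\<rho> N) F - s a / s0 = (\<Sum>\<nu>\<in>S N. w N \<nu> / s0 * (F (\<tau> N \<nu>) - G \<nu>))"
            unfolding sa int[OF Fm] by (simp only: sum_subtractf right_diff_distrib)
          also have "norm \<dots> \<le> (\<Sum>\<nu>\<in>S N. w N \<nu> / s0 * ?K)"
          proof (rule sum_norm_le)
            fix \<nu> assume \<nu>: "\<nu> \<in> S N"
            have "\<bar>F (\<tau> N \<nu>) - G \<nu>\<bar> \<le> ?K"
              unfolding F_def G_def \<tau>(2)[OF \<nu>] vec_lambda_beta
              using \<nu> aN elim by (intro multi_binomial_ratio_approx) (auto simp: S_def)
            thus "norm (w N \<nu> / s0 * (F (\<tau> N \<nu>) - G \<nu>)) \<le> w N \<nu> / s0 * ?K"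
              using w[of N \<nu>] s0 by (simp only: real_norm_def abs_mult abs_of_nonneg[of "w N \<nu> / s0"] divide_nonneg_pos)
                (intro mult_left_mono; simp)
          qed
          also have "\<dots> = (\<Sum>\<nu>\<in>S N. w N \<nu>) / s0 * ?K"
            by (simp only: sum_distrib_right sum_divide_distrib)
          also have "\<dots> = norm (1 / real N) * (\<Sum>i\<in>UNIV. real (a i) ^ 2)"
            using s0 by (simp add: wsum)
          finally show ?case .
        qed
      qed
      from LIMSEQ_subseq_LIMSEQ[OF this r] lim1
      show ?thesis unfolding F_def o_def using LIMSEQ_unique by blast
    qed
    \<comment> \<open>The limit on the line is pushed forward along the curve, and the normalization
      by \<open>s0\<close> is undone.\<close>
    define \<mu> where "\<mu> = density (distr M borel f) (\<lambda>_. ennreal s0)"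
    show ?thesis
    proof (rule that)
      show "sets \<mu> = sets borel" by (simp add: \<mu>_def)
      show "finite_measure \<mu>"
        using M.emeasure_space_1
        by (intro finite_measureI) (simp add: \<mu>_def emeasure_density emeasure_distr ennreal_mult_eq_top_iff)
      show "AE x in \<mu>. \<forall>i. 0 \<le> x $ i \<and> x $ i \<le> 1"
        unfolding \<mu>_def using f(2,3) by (simp add: AE_density AE_distr_iff)
      show "(\<integral>x. (\<Prod>i\<in>UNIV. x $ i ^ a i) \<partial>\<mu>) = s a" for a
        using s0 moment[of a] by (simp add: \<mu>_def integral_density integral_distr)
    qed
  qed
qed

section \<open>Positive semidefinite Hermitian kernels\<close>

definition herm_psd :: "('a \<Rightarrow> 'a \<Rightarrow> complex) \<Rightarrow> bool" where
  "herm_psd M \<longleftrightarrow> (\<forall>a b. cnj (M a b) = M b a) \<and>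
     (\<forall>F v. finite F \<longrightarrow> 0 \<le> Re (\<Sum>a\<in>F. \<Sum>b\<in>F. cnj (v a) * M a b * v b))"

text \<open>The map \<open>f\<close> may repeat indices: coefficients with the same image are added
  up, which turns the form into an ordinary one on the image. This is what makes reindexing by
  arbitrary maps harmless.\<close>

lemma herm_psd_family:
  assumes "herm_psd M" "finite J"
  shows "0 \<le> Re (\<Sum>p\<in>J. \<Sum>q\<in>J. cnj (c p) * M (f p) (f q) * c q)"
proof -
  define v where "v x = (\<Sum>p | p \<in> J \<and> f p = x. c p)" for x
  have gen: "(\<Sum>q\<in>J. h (f q) * c q) = (\<Sum>x\<in>f ` J. h x * v x)" for h
    unfolding v_def by (subst sum.image_gen[OF assms(2), of _ f]) (auto simp: sum_distrib_left intro!: sum.cong)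
  have gen': "(\<Sum>q\<in>J. cnj (c q) * h (f q)) = (\<Sum>x\<in>f ` J. cnj (v x) * h x)" for h
    unfolding v_def by (subst sum.image_gen[OF assms(2), of _ f]) (auto simp: sum_distrib_right intro!: sum.cong)
  have "(\<Sum>p\<in>J. \<Sum>q\<in>J. cnj (c p) * M (f p) (f q) * c q) =
        (\<Sum>p\<in>J. cnj (c p) * (\<Sum>q\<in>J. M (f p) (f q) * c q))"
    by (simp add: sum_distrib_left mult.assoc)
  also have "\<dots> = (\<Sum>p\<in>J. cnj (c p) * (\<Sum>y\<in>f ` J. M (f p) y * v y))"
    by (simp only: gen)
  also have "\<dots> = (\<Sum>x\<in>f ` J. cnj (v x) * (\<Sum>y\<in>f ` J. M x y * v y))"
    by (rule gen')
  also have "\<dots> = (\<Sum>x\<in>f ` J. \<Sum>y\<in>f ` J. cnj (v x) * M x y * v y)"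
    by (simp add: sum_distrib_left mult.assoc)
  finally show ?thesis using assms by (auto simp: herm_psd_def)
qed

lemma herm_psd_add:
  assumes "herm_psd M" "herm_psd N"
  shows "herm_psd (\<lambda>a b. M a b + N a b)"
  using assms by (auto simp: herm_psd_def algebra_simps sum.distrib)

lemma herm_psd_scale:
  assumes "herm_psd M" "0 \<le> r"
  shows "herm_psd (\<lambda>a b. complex_of_real r * M a b)"
proof -
  have "0 \<le> Re (\<Sum>a\<in>F. \<Sum>b\<in>F. cnj (v a) * (complex_of_real r * M a b) * v b)" if "finite F" for F v
  proof -
    have "(\<Sum>a\<in>F. \<Sum>b\<in>F. cnj (v a) * (complex_of_real r * M a b) * v b) =
          complex_of_real r * (\<Sum>a\<in>F. \<Sum>b\<in>F. cnj (v a) * M a b * v b)"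
      by (simp add: sum_distrib_left mult_ac)
    thus ?thesis using assms that by (simp add: herm_psd_def)
  qed
  thus ?thesis using assms by (auto simp: herm_psd_def)
qed

lemma herm_psd_reindex: "herm_psd M \<Longrightarrow> herm_psd (\<lambda>a b. M (f a) (f b))"
  using herm_psd_family[of M _ _ f] by (auto simp: herm_psd_def)

lemma herm_psd_sum:
  assumes "finite I" "\<And>i. i \<in> I \<Longrightarrow> herm_psd (M i)"
  shows "herm_psd (\<lambda>a b. \<Sum>i\<in>I. M i a b)"
  using assms
proof (induction I)
  case empty
  thus ?case by (simp add: herm_psd_def)
next
  case (insert i I)
  thus ?case by (simp add: herm_psd_add)
qed

text \<open>When \<open>T\<close> raises the exponent of z_j, this is the kernel of moments
  multiplied by |a + b z_j|^2. Its form at v is the form of M at the vector that puts a v(x) on x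
  and b v(x) on T x; the Boolean in the proof tells the two copies apart.\<close>

lemma herm_psd_square:
  assumes "herm_psd M"
  shows "herm_psd (\<lambda>x y. cnj a * a * M x y + cnj a * b * M x (T y) + cnj b * a * M (T x) y + cnj b * b * M (T x) (T y))"
proof -
  have "0 \<le> Re (\<Sum>x\<in>F. \<Sum>y\<in>F. cnj (v x) * (cnj a * a * M x y + cnj a * b * M x (T y) + cnj b * a * M (T x) y + cnj b * b * M (T x) (T y)) * v y)"
    if F: "finite F" for F v
  proof -
    define f where "f p = (if snd p then T (fst p) else fst p)" for p
    define c where "c p = (if snd p then b else a) * v (fst p)" for p
    have prod: "(\<Sum>p\<in>F \<times> UNIV. h p) = (\<Sum>x\<in>F. \<Sum>e\<in>UNIV. h (x, e))" for h :: "'a \<times> bool \<Rightarrow> complex"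
      by (simp add: sum.cartesian_product)
    have "(\<Sum>p\<in>F \<times> UNIV. \<Sum>q\<in>F \<times> UNIV. cnj (c p) * M (f p) (f q) * c q) =
      (\<Sum>x\<in>F. \<Sum>e\<in>UNIV. \<Sum>y\<in>F. \<Sum>e'\<in>UNIV. cnj (c (x, e)) * M (f (x, e)) (f (y, e')) * c (y, e'))"
      by (simp only: prod)
    also have "\<dots> = (\<Sum>x\<in>F. \<Sum>y\<in>F. cnj (v x) * (cnj a * a * M x y + cnj a * b * M x (T y) + cnj b * a * M (T x) y + cnj b * b * M (T x) (T y)) * v y)"
      by (simp add: UNIV_bool c_def f_def sum.distrib[symmetric] algebra_simps)
    finally show ?thesis using herm_psd_family[OF assms, of "F \<times> UNIV" c f] F by simp
  qed
  moreover have "cnj (M x y) = M y x" for x y using assms by (simp add: herm_psd_def)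
  ultimately show ?thesis by (simp add: herm_psd_def algebra_simps)
qed

text \<open>The form vanishes identically, and polarization recovers the entries: after the
  diagonal, the vectors (1, c) with c = 1 and c = \<open>\<i>\<close> isolate the real and the
  imaginary part of \<open>M a b\<close>. The case a = b is covered because families may repeat an
  index.\<close>

lemma herm_psd_antisym:
  assumes M: "herm_psd M" and N: "herm_psd (\<lambda>a b. - M a b)"
  shows "M a b = 0"
proof -
  have re0: "Re (\<Sum>p\<in>J. \<Sum>q\<in>J. cnj (c p) * M (f p) (f q) * c q) = 0" if "finite J" for J :: "bool set" and c f
    using herm_psd_family[OF M that, of c f] herm_psd_family[OF N that, of c f]
    by (simp add: sum_negf)
  have sym: "cnj (M x y) = M y x" for x y using M by (simp add: herm_psd_def)
  have diag: "Re (M x x) = 0" for x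
    using re0[of "{True}" "\<lambda>_. 1" "\<lambda>_. x"] by simp
  have off: "Re (M a b * c) = 0" if "cmod c = 1" for c
  proof -
    have cc: "cnj c * c = 1" using that by (simp add: complex_norm_square[symmetric] mult.commute)
    have "cnj c * M b b * c = (cnj c * c) * M b b" by (simp add: mult_ac)
    hence bb: "cnj c * M b b * c = M b b" using cc by simp
    have ba: "cnj c * M b a = cnj (M a b * c)" by (simp add: sym)
    have "Re (M a a + M a b * c + (cnj c * M b a + cnj c * M b b * c)) = 0"
      using re0[of UNIV "\<lambda>e. if e then 1 else c" "\<lambda>e. if e then a else b"]
      by (simp add: UNIV_bool algebra_simps)
    thus ?thesis unfolding bb ba by (simp add: diag mult.commute)
  qed
  show ?thesis using off[of 1] off[of \<i>] by (simp add: complex_eq_iff)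
qed

section \<open>Moment sequences on a sphere\<close>

lemma multiindex_induct [case_names zero inc]:
  fixes a :: "'k::finite \<Rightarrow> nat"
  assumes "P (\<lambda>_. 0)" and "\<And>a i. P a \<Longrightarrow> P (binc i a)"
  shows "P a"
proof (induction "\<Sum>i\<in>UNIV. a i" arbitrary: a)
  case 0
  hence "a = (\<lambda>_. 0)" by auto
  thus ?case using assms(1) by simp
next
  case (Suc n)
  have "\<exists>i. a i \<noteq> 0"
  proof (rule ccontr)
    assume "\<not> ?thesis"
    thus False using Suc(2) by simp
  qed
  then obtain i where i: "a i \<noteq> 0" by blast
  define a' where "a' = a(i := a i - 1)"
  have a: "a = binc i a'" using i by (auto simp: a'_def binc_def)
  have "Suc n = a i + (\<Sum>j\<in>UNIV - {i}. a j)"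
    unfolding Suc(2) by (subst sum.remove[of _ i]) auto
  moreover have "(\<Sum>j\<in>UNIV. a' j) = a i - 1 + (\<Sum>j\<in>UNIV - {i}. a j)"
    by (subst sum.remove[of _ i]) (auto simp: a'_def)
  ultimately have "n = (\<Sum>j\<in>UNIV. a' j)" using i by simp
  thus ?case unfolding a by (intro assms(2) Suc(1))
qed

text \<open>\<open>w a\<close> is the composite of the powers U_i^(a i) applied to x. Commutation
  makes the order irrelevant, so a fold over the finite index type defines it and any chosen U_i can
  be taken outermost.\<close>

lemma commuting_orbit:
  fixes U :: "'k::finite \<Rightarrow> 'a \<Rightarrow> 'a"
  assumes comm: "\<And>i j x. U i (U j x) = U j (U i x)"
  obtains w where "w (\<lambda>_. 0) = x" "\<And>a i. w (binc i a) = U i (w a)"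
proof
  have c1: "(U i ^^ m) (U j x) = U j ((U i ^^ m) x)" for i j m x
    by (induction m) (simp_all add: comm)
  have c2: "(U i ^^ m) ((U j ^^ n) x) = (U j ^^ n) ((U i ^^ m) x)" for i j m n x
    by (induction n) (simp_all add: c1)
  have ccomm: "comp_fun_commute (\<lambda>i. U i ^^ a i)" for a
    by standard (simp add: fun_eq_iff c2)
  define w where "w a = Finite_Set.fold (\<lambda>i. U i ^^ a i) x UNIV" for a :: "'k \<Rightarrow> nat"
  have "Finite_Set.fold (\<lambda>i. U i ^^ 0) x A = x" if "finite A" for A
    using that
  proof induction
    case (insert i A)
    interpret comp_fun_commute "\<lambda>i. U i ^^ (\<lambda>_. 0) i" by (rule ccomm)
    show ?case using insert fold_insert[of A i x] by (simp add: id_def)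
  qed simp
  thus "w (\<lambda>_. 0) = x" by (simp add: w_def)
  show "w (binc i a) = U i (w a)" for i a
  proof -
    have rec: "w b = (U i ^^ b i) (Finite_Set.fold (\<lambda>i. U i ^^ b i) x (UNIV - {i}))" for b
    proof -
      interpret comp_fun_commute "\<lambda>i. U i ^^ b i" by (rule ccomm)
      show ?thesis unfolding w_def by (rule fold_rec) auto
    qed
    have "Finite_Set.fold (\<lambda>j. U j ^^ binc i a j) x (UNIV - {i}) =
          Finite_Set.fold (\<lambda>j. U j ^^ a j) x (UNIV - {i})"
      using ccomm by (intro Finite_Set.fold_cong) (auto simp: binc_def comp_fun_commute_def')
    thus ?thesis unfolding rec[of a] rec[of "binc i a"] by (simp add: binc_def)
  qed
qed

text \<open>The second condition says that the functional given by y annihilates every multiple of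
  |z|^2 - R^2 by a monomial in conj z and z.\<close>

definition spherical_moments :: "real \<Rightarrow> (('n::finite \<Rightarrow> nat) \<Rightarrow> ('n \<Rightarrow> nat) \<Rightarrow> complex) set" where
  "spherical_moments R = {y. herm_psd y \<and>
     (\<forall>\<alpha> \<beta>. (\<Sum>j\<in>UNIV. y (binc j \<alpha>) (binc j \<beta>)) = complex_of_real (R\<^sup>2) * y \<alpha> \<beta>)}"

text \<open>Multiplication of the measure by 1/2 + 2 Re (d z_j), on the level of moments.\<close>

definition mult_affine :: "'n \<Rightarrow> complex \<Rightarrow> (('n \<Rightarrow> nat) \<Rightarrow> ('n \<Rightarrow> nat) \<Rightarrow> complex) \<Rightarrow>
    ('n \<Rightarrow> nat) \<Rightarrow> ('n \<Rightarrow> nat) \<Rightarrow> complex" where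
  "mult_affine j d y = (\<lambda>\<alpha> \<beta>. y \<alpha> \<beta> / 2 + cnj d * y (binc j \<alpha>) \<beta> + d * y \<alpha> (binc j \<beta>))"

lemma binc_commute: "binc i (binc j \<alpha>) = binc j (binc i \<alpha>)"
  by (auto simp: binc_def fun_eq_iff)

lemma mult_affine_commute: "mult_affine i d (mult_affine j e y) = mult_affine j e (mult_affine i d y)"
  by (simp add: mult_affine_def fun_eq_iff binc_commute[of i j] algebra_simps add_divide_distrib)

text \<open>On the sphere, 1/2 + 2 Re (d z_j) is |1/2 + 2 d z_j|^2 plus 1/(4 R^2) times the sum of |z_i|^2
  over i distinct from j.\<close>

lemma mult_affine_spherical:
  fixes y :: "('n::finite \<Rightarrow> nat) \<Rightarrow> ('n \<Rightarrow> nat) \<Rightarrow> complex"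
  assumes y: "y \<in> spherical_moments R" and R: "0 < R" and d: "cmod d = 1 / (4 * R)"
  shows "mult_affine j d y \<in> spherical_moments R"
proof -
  have psd: "herm_psd y" and sph: "\<And>\<alpha> \<beta>. (\<Sum>j\<in>UNIV. y (binc j \<alpha>) (binc j \<beta>)) = complex_of_real (R\<^sup>2) * y \<alpha> \<beta>"
    using y by (auto simp: spherical_moments_def)
  \<comment> \<open>r = |2 d|^2 is also the weight of the remaining |z_i|^2, so the |z_j|^2 terms
    cancel on the sphere, and r R^2 = 1/4 raises the constant 1/4 of the square to 1/2.\<close>
  define r where "r = 1 / (4 * R\<^sup>2)"
  have dd: "cnj (2 * d) * (2 * d) = complex_of_real r"
  proof -
    have "cnj (2 * d) * (2 * d) = 4 * (d * cnj d)" by simp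
    also have "\<dots> = complex_of_real (4 * (cmod d)\<^sup>2)" by (simp only: complex_norm_square of_real_mult of_real_numeral)
    also have "4 * (cmod d)\<^sup>2 = r" by (simp add: d r_def power2_eq_square)
    finally show ?thesis .
  qed
  have "mult_affine j d y = (\<lambda>\<alpha> \<beta>. (cnj (1/2) * (1/2) * y \<alpha> \<beta> + cnj (1/2) * (2 * d) * y \<alpha> (binc j \<beta>)
      + cnj (2 * d) * (1/2) * y (binc j \<alpha>) \<beta> + cnj (2 * d) * (2 * d) * y (binc j \<alpha>) (binc j \<beta>))
      + complex_of_real r * (\<Sum>i\<in>UNIV - {j}. y (binc i \<alpha>) (binc i \<beta>)))"
  proof (intro ext)
    fix \<alpha> \<beta>
    have rest: "(\<Sum>i\<in>UNIV - {j}. y (binc i \<alpha>) (binc i \<beta>)) =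
      complex_of_real (R\<^sup>2) * y \<alpha> \<beta> - y (binc j \<alpha>) (binc j \<beta>)"
      unfolding sph[symmetric] by (subst (2) sum.remove[of _ j]) auto
    have quarter: "complex_of_real r * (complex_of_real (R\<^sup>2) * y \<alpha> \<beta>) = y \<alpha> \<beta> / 4"
      using R by (simp add: r_def)
    show "mult_affine j d y \<alpha> \<beta> = (cnj (1/2) * (1/2) * y \<alpha> \<beta> + cnj (1/2) * (2 * d) * y \<alpha> (binc j \<beta>)
      + cnj (2 * d) * (1/2) * y (binc j \<alpha>) \<beta> + cnj (2 * d) * (2 * d) * y (binc j \<alpha>) (binc j \<beta>))
      + complex_of_real r * (\<Sum>i\<in>UNIV - {j}. y (binc i \<alpha>) (binc i \<beta>))"
      unfolding dd rest right_diff_distrib quarter by (simp add: mult_affine_def)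
  qed
  moreover have "herm_psd \<dots>"
    by (rule herm_psd_add, rule herm_psd_square[OF psd], rule herm_psd_scale,
        rule herm_psd_sum, simp, rule herm_psd_reindex[OF psd], simp add: r_def)
  ultimately have "herm_psd (mult_affine j d y)" by simp
  moreover have "(\<Sum>i\<in>UNIV. mult_affine j d y (binc i \<alpha>) (binc i \<beta>)) =
      complex_of_real (R\<^sup>2) * mult_affine j d y \<alpha> \<beta>" for \<alpha> \<beta>
    by (simp add: mult_affine_def binc_commute[of j] sum.distrib sum_distrib_left[symmetric]
        sum_divide_distrib[symmetric] sph algebra_simps)
  ultimately show ?thesis by (simp add: spherical_moments_def)
qed

section \<open>From spherical moments to a measure with bounded support\<close>

lemma integrable_continuous_AE_compact:
  fixes h :: "'a::euclidean_space \<Rightarrow> 'b::{banach, second_countable_topology}"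
  assumes "sets \<mu> = sets borel" "finite_measure \<mu>" "compact C" "AE x in \<mu>. x \<in> C" "continuous_on UNIV h"
  shows "integrable \<mu> h"
proof -
  interpret finite_measure \<mu> by fact
  have "bounded (h ` C)"
    using assms by (intro compact_imp_bounded compact_continuous_image continuous_on_subset[OF assms(5)]) auto
  then obtain B where "\<And>x. x \<in> C \<Longrightarrow> norm (h x) \<le> B" by (auto simp: bounded_iff)
  moreover have "h \<in> borel_measurable \<mu>"
    unfolding measurable_cong_sets[OF assms(1) refl] by (rule borel_measurable_continuous_onI[OF assms(5)])
  ultimately show ?thesis
    using assms(4) by (intro integrable_const_bound[of _ B]) auto
qed

lemma cmono_0: "cmono z (\<lambda>_. 0) = 1"
  by (simp add: cmono_def)

lemma cmono_binc: "cmono z (binc j \<alpha>) = z $ j * cmono z \<alpha>"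
proof -
  have "cmono z (binc j \<alpha>) = z $ j ^ Suc (\<alpha> j) * (\<Prod>i\<in>UNIV - {j}. (z $ i) ^ \<alpha> i)"
    unfolding cmono_def by (subst prod.remove[of _ j]) (auto simp: binc_def)
  moreover have "cmono z \<alpha> = z $ j ^ \<alpha> j * (\<Prod>i\<in>UNIV - {j}. (z $ i) ^ \<alpha> i)"
    unfolding cmono_def by (subst prod.remove[of _ j]) auto
  ultimately show ?thesis by simp
qed

lemma cmono_mi_add: "cmono z (mi_add \<alpha> \<beta>) = cmono z \<alpha> * cmono z \<beta>"
  by (simp add: cmono_def mi_add_def power_add prod.distrib)

lemma continuous_on_cmono [continuous_intros]:
  assumes "continuous_on S f"
  shows "continuous_on S (\<lambda>x. cmono (f x) \<alpha>)"
  unfolding cmono_def by (intro continuous_intros assms)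

text \<open>Applying the coordinate multiplications repeatedly to y and reading off the entry at (0,
  0) gives a completely monotone sequence in 2n variables. Its measure on the cube, carried back to
  C^n, has the right moments because z_j and conj z_j are affine in the coordinates.\<close>

lemma spherical_moments_representable:
  fixes y :: "('n::finite \<Rightarrow> nat) \<Rightarrow> ('n \<Rightarrow> nat) \<Rightarrow> complex"
  assumes y: "y \<in> spherical_moments R" and R: "0 < R"
  obtains \<mu> :: "(complex ^ 'n) measure" where "sets \<mu> = sets borel" "finite_measure \<mu>"
    "AE z in \<mu>. z \<in> cball 0 (2 * R * CARD('n))"
    "\<And>\<alpha> \<beta>. (\<integral>z. cnj (cmono z \<alpha>) * cmono z \<beta> \<partial>\<mu>) = y \<alpha> \<beta>"
proof -
  \<comment> \<open>With these constants 1/2 + 2 Re (d z_j) is (1 + Re z_j / R) / 2 for the tag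
    \<open>False\<close> and (1 + Im z_j / R) / 2 for \<open>True\<close>.\<close>
  define d where "d k = (if snd k then - \<i> / (4 * R) else 1 / complex_of_real (4 * R))" for k :: "'n \<times> bool"
  define U where "U k = mult_affine (fst k) (d k)" for k
  have dn: "cmod (d k) = 1 / (4 * R)" for k
    using R by (auto simp: d_def norm_divide norm_mult)
  have Usph: "U k t \<in> spherical_moments R" if "t \<in> spherical_moments R" for k t
    unfolding U_def by (rule mult_affine_spherical[OF that R dn])
  have Vsph: "(\<lambda>\<alpha> \<beta>. t \<alpha> \<beta> - U k t \<alpha> \<beta>) \<in> spherical_moments R" if "t \<in> spherical_moments R" for k t
  proof -
    \<comment> \<open>The complement 1 - x_k is the same affine function with d replaced by -d, so
      the same positivity lemma covers it.\<close>
    have "(\<lambda>\<alpha> \<beta>. t \<alpha> \<beta> - U k t \<alpha> \<beta>) = mult_affine (fst k) (- d k) t"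
      by (simp add: U_def mult_affine_def fun_eq_iff)
    thus ?thesis using mult_affine_spherical[OF that R, of "- d k"] dn by simp
  qed
  define orbit where "orbit w \<longleftrightarrow> (\<forall>a k. w (binc k a) = U k (w a)) \<and> (\<forall>a. w a \<in> spherical_moments R)" for w
  obtain w where w0: "w (\<lambda>_. 0) = y" and w1: "\<And>a k. w (binc k a) = U k (w a)"
    by (rule commuting_orbit[of U y]) (auto simp: U_def mult_affine_commute)
  have "w a \<in> spherical_moments R" for a
    by (induction a rule: multiindex_induct) (auto simp: w0 w1 y intro: Usph)
  hence w: "orbit w" using w1 by (simp add: orbit_def)
  define Q where "Q = {\<lambda>a. Re (w a (\<lambda>_. 0) (\<lambda>_. 0)) | w. orbit w}"
  have sQ: "(\<lambda>a. Re (w a (\<lambda>_. 0) (\<lambda>_. 0))) \<in> Q" using w by (auto simp: Q_def)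
  have Q: "0 \<le> t (\<lambda>_. 0)" "(\<lambda>a. t (binc k a)) \<in> Q" "(\<lambda>a. t a - t (binc k a)) \<in> Q" if "t \<in> Q" for t k
  proof -
    from that obtain w where w: "orbit w" and t: "t = (\<lambda>a. Re (w a (\<lambda>_. 0) (\<lambda>_. 0)))" by (auto simp: Q_def)
    have "herm_psd (w (\<lambda>_. 0))" using w by (simp add: orbit_def spherical_moments_def)
    from herm_psd_family[OF this, of "{True}" "\<lambda>_. 1" "\<lambda>_. (\<lambda>_. 0)"]
    show "0 \<le> t (\<lambda>_. 0)" by (simp add: t)
    have "orbit (\<lambda>a. w (binc k a))"
      using w by (simp add: orbit_def binc_commute[of k])
    thus "(\<lambda>a. t (binc k a)) \<in> Q" by (auto simp: Q_def t)
    have "orbit (\<lambda>a \<alpha> \<beta>. w a \<alpha> \<beta> - U k (w a) \<alpha> \<beta>)"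
      unfolding orbit_def
    proof (intro conjI allI)
      fix a l
      have "U k (U l (w a)) = U l (U k (w a))" by (simp add: U_def mult_affine_commute)
      moreover have "U l (\<lambda>\<alpha> \<beta>. w a \<alpha> \<beta> - U k (w a) \<alpha> \<beta>) = (\<lambda>\<alpha> \<beta>. U l (w a) \<alpha> \<beta> - U l (U k (w a)) \<alpha> \<beta>)"
        by (simp add: U_def[of l] mult_affine_def fun_eq_iff algebra_simps diff_divide_distrib)
      moreover have "w (binc l a) = U l (w a)" using w by (simp only: orbit_def)
      ultimately show "(\<lambda>\<alpha> \<beta>. w (binc l a) \<alpha> \<beta> - U k (w (binc l a)) \<alpha> \<beta>) = U l (\<lambda>\<alpha> \<beta>. w a \<alpha> \<beta> - U k (w a) \<alpha> \<beta>)"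
        by simp
    qed (use w in \<open>auto simp: orbit_def intro: Vsph\<close>)
    moreover have "t (binc k a) = Re (U k (w a) (\<lambda>_. 0) (\<lambda>_. 0))" for a
      using w by (simp only: t orbit_def)
    ultimately show "(\<lambda>a. t a - t (binc k a)) \<in> Q"
      unfolding Q_def by (auto simp: t intro!: exI[of _ "\<lambda>a \<alpha> \<beta>. w a \<alpha> \<beta> - U k (w a) \<alpha> \<beta>"])
  qed
  have "\<exists>\<nu> :: (real ^ ('n \<times> bool)) measure. sets \<nu> = sets borel \<and> finite_measure \<nu> \<and>
      (AE x in \<nu>. \<forall>i. 0 \<le> x $ i \<and> x $ i \<le> 1) \<and>
      (\<forall>a. (\<integral>x. (\<Prod>i\<in>UNIV. x $ i ^ a i) \<partial>\<nu>) = Re (w a (\<lambda>_. 0) (\<lambda>_. 0)))"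
    by (rule hausdorff_moment_problem[where Q = Q and s = "\<lambda>a. Re (w a (\<lambda>_. 0) (\<lambda>_. 0))"],
        fact Q(1), fact Q(2), fact Q(3), fact sQ) blast
  then obtain \<nu> :: "(real ^ ('n \<times> bool)) measure" where \<nu>: "sets \<nu> = sets borel" "finite_measure \<nu>"
    "AE x in \<nu>. \<forall>i. 0 \<le> x $ i \<and> x $ i \<le> 1"
    "\<And>a. (\<integral>x. (\<Prod>i\<in>UNIV. x $ i ^ a i) \<partial>\<nu>) = Re (w a (\<lambda>_. 0) (\<lambda>_. 0))"
    by blast
  define \<zeta> :: "real ^ ('n \<times> bool) \<Rightarrow> complex ^ 'n" where
    "\<zeta> x = (\<chi> j. of_real (R * (2 * x $ (j, False) - 1)) + \<i> * of_real (R * (2 * x $ (j, True) - 1)))" for x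
  have \<zeta>c: "continuous_on UNIV \<zeta>"
    unfolding \<zeta>_def by (intro continuous_intros)
  define X where "X a x = complex_of_real (\<Prod>i\<in>UNIV. x $ i ^ a i)" for a and x :: "real ^ ('n \<times> bool)"
  have X_binc: "X (binc k a) x = of_real (x $ k) * X a x" for k a x
    by (simp add: X_def prod_UNIV_remove[of _ k] binc_def)
  have box: "AE x in \<nu>. x \<in> cbox 0 1"
    using \<nu>(3) by eventually_elim (simp add: mem_box_cart)
  have int: "integrable \<nu> (\<lambda>x. X a x * (cnj (cmono (\<zeta> x) \<alpha>) * cmono (\<zeta> x) \<beta>))" for a \<alpha> \<beta>
    unfolding X_def by (intro integrable_continuous_AE_compact[OF \<nu>(1,2) _ box] continuous_intros \<zeta>c) auto
  \<comment> \<open>\<open>B\<close> and \<open>A\<close> write multiplication by z_j and by conj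
    z_j through the two coordinate multiplications, on the level of moments; \<open>\<zeta>\<close>
    satisfies the same relations pointwise.\<close>
  have B: "t \<alpha> (binc j \<beta>) = of_real R * (2 * U (j, False) t \<alpha> \<beta> - t \<alpha> \<beta>) +
                \<i> * of_real R * (2 * U (j, True) t \<alpha> \<beta> - t \<alpha> \<beta>)" for t \<alpha> \<beta> j
    using R by (simp add: U_def mult_affine_def d_def field_simps)
  have A: "t (binc j \<alpha>) \<beta> = of_real R * (2 * U (j, False) t \<alpha> \<beta> - t \<alpha> \<beta>) -
                \<i> * of_real R * (2 * U (j, True) t \<alpha> \<beta> - t \<alpha> \<beta>)" for t \<alpha> \<beta> j
    using R by (simp add: U_def mult_affine_def d_def field_simps)
  \<comment> \<open>The exponent \<open>a\<close> stays general since trading a z_j or conj z_j for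
    coordinates raises it. The base case is the Hausdorff moment identity, the entry at (0, 0) being
    real; a = 0 is the claim about y.\<close>
  have main: "(\<integral>x. X a x * (cnj (cmono (\<zeta> x) \<alpha>) * cmono (\<zeta> x) \<beta>) \<partial>\<nu>) = w a \<alpha> \<beta>" for a \<alpha> \<beta>
  proof (induction \<beta> arbitrary: a rule: multiindex_induct)
    case zero
    show ?case
    proof (induction \<alpha> arbitrary: a rule: multiindex_induct)
      case zero
      have "cnj (w a (\<lambda>_. 0) (\<lambda>_. 0)) = w a (\<lambda>_. 0) (\<lambda>_. 0)"
        using w by (simp add: orbit_def spherical_moments_def herm_psd_def)
      hence "w a (\<lambda>_. 0) (\<lambda>_. 0) = of_real (Re (w a (\<lambda>_. 0) (\<lambda>_. 0)))"
        by (simp add: complex_eq_iff)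
      also have "\<dots> = (\<integral>x. X a x \<partial>\<nu>)" unfolding \<nu>(4)[symmetric] X_def
        by (rule integral_complex_of_real[symmetric])
      finally show ?case by (simp add: cmono_0)
    next
      case (inc \<alpha> j)
      define h where "h a x = X a x * (cnj (cmono (\<zeta> x) \<alpha>) * cmono (\<zeta> x) (\<lambda>_. 0))" for a x
      have [simp]: "integrable \<nu> (h a)" for a unfolding h_def by (rule int)
      have IH: "(\<integral>x. h b x \<partial>\<nu>) = w b \<alpha> (\<lambda>_. 0)" for b unfolding h_def by (rule inc.IH)
      have "(\<integral>x. X a x * (cnj (cmono (\<zeta> x) (binc j \<alpha>)) * cmono (\<zeta> x) (\<lambda>_. 0)) \<partial>\<nu>) =
        (\<integral>x. of_real R * (2 * h (binc (j, False) a) x - h a x) - \<i> * of_real R * (2 * h (binc (j, True) a) x - h a x) \<partial>\<nu>)"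
        by (intro Bochner_Integration.integral_cong refl) (simp add: h_def cmono_binc X_binc \<zeta>_def algebra_simps)
      also have "\<dots> = w a (binc j \<alpha>) (\<lambda>_. 0)"
        by (simp add: IH w1 A[of "w a"])
      finally show ?case .
    qed
  next
    case (inc \<beta> j)
    define h where "h a x = X a x * (cnj (cmono (\<zeta> x) \<alpha>) * cmono (\<zeta> x) \<beta>)" for a x
    have [simp]: "integrable \<nu> (h a)" for a unfolding h_def by (rule int)
    have IH: "(\<integral>x. h b x \<partial>\<nu>) = w b \<alpha> \<beta>" for b unfolding h_def by (rule inc.IH)
    have "(\<integral>x. X a x * (cnj (cmono (\<zeta> x) \<alpha>) * cmono (\<zeta> x) (binc j \<beta>)) \<partial>\<nu>) =
      (\<integral>x. of_real R * (2 * h (binc (j, False) a) x - h a x) + \<i> * of_real R * (2 * h (binc (j, True) a) x - h a x) \<partial>\<nu>)"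
      by (intro Bochner_Integration.integral_cong refl) (simp add: h_def cmono_binc X_binc \<zeta>_def algebra_simps)
    also have "\<dots> = w a \<alpha> (binc j \<beta>)"
      by (simp add: IH w1 B[of "w a"])
    finally show ?case .
  qed
  have \<zeta>m: "\<zeta> \<in> measurable \<nu> borel"
    unfolding measurable_cong_sets[OF \<nu>(1) refl] by (rule borel_measurable_continuous_onI[OF \<zeta>c])
  show ?thesis
  proof (rule that)
    show "sets (distr \<nu> borel \<zeta>) = sets borel" by simp
    show "finite_measure (distr \<nu> borel \<zeta>)" by (rule finite_measure.finite_measure_distr[OF \<nu>(2) \<zeta>m])
    \<comment> \<open>A crude bound: on the cube each |z_j| is at most 2 R, and the norm is at most
      the sum of these moduli.\<close>
    show "AE z in distr \<nu> borel \<zeta>. z \<in> cball 0 (2 * R * CARD('n))"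
    proof (subst AE_distr_iff[OF \<zeta>m])
      show "AE x in \<nu>. \<zeta> x \<in> cball 0 (2 * R * CARD('n))"
        using \<nu>(3)
      proof eventually_elim
        case (elim x)
        have le: "\<bar>R * (2 * x $ k - 1)\<bar> \<le> R" for k
        proof -
          have "\<bar>2 * x $ k - 1\<bar> \<le> 1" using elim[rule_format, of k] by linarith
          thus ?thesis using R by (simp add: abs_mult mult_le_cancel_left1)
        qed
        have "norm (\<zeta> x) \<le> (\<Sum>j\<in>UNIV. norm (\<zeta> x $ j))"
          by (simp add: norm_vec_def L2_set_le_sum)
        also have "\<dots> \<le> (\<Sum>j\<in>(UNIV :: 'n set). 2 * R)"
        proof (rule sum_mono)
          fix j
          have "norm (\<zeta> x $ j) \<le> \<bar>R * (2 * x $ (j, False) - 1)\<bar> + \<bar>R * (2 * x $ (j, True) - 1)\<bar>"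
            unfolding \<zeta>_def vec_lambda_beta
            by (rule order_trans[OF norm_triangle_ineq]) (simp only: norm_mult norm_ii norm_of_real mult_1 order_refl)
          thus "norm (\<zeta> x $ j) \<le> 2 * R" using le[of "(j, False)"] le[of "(j, True)"] by linarith
        qed
        finally show ?case by (simp add: mult_ac)
      qed
    qed simp
    fix \<alpha> \<beta>
    have "(\<integral>z. cnj (cmono z \<alpha>) * cmono z \<beta> \<partial>distr \<nu> borel \<zeta>) = (\<integral>x. cnj (cmono (\<zeta> x) \<alpha>) * cmono (\<zeta> x) \<beta> \<partial>\<nu>)"
      by (intro integral_distr \<zeta>m borel_measurable_continuous_onI continuous_intros)
    also have "\<dots> = y \<alpha> \<beta>" using main[of "\<lambda>_. 0" \<alpha> \<beta>] by (simp add: X_def w0)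
    finally show "(\<integral>z. cnj (cmono z \<alpha>) * cmono z \<beta> \<partial>distr \<nu> borel \<zeta>) = y \<alpha> \<beta>" .
  qed
qed

section \<open>Localizing matrices\<close>

lemma finite_midx: "finite (midx d)"
proof -
  have "\<alpha> i \<le> d" if "\<alpha> \<in> midx d" for \<alpha> i
    using that member_le_sum[of i UNIV \<alpha>] by (simp add: midx_def mi_deg_def)
  thus ?thesis by (intro finite_subset[OF _ finite_box[of d]]) auto
qed

lemma continuous_on_hpoly: "continuous_on S (hpoly c k)"
  unfolding hpoly_def by (intro continuous_intros)

lemma hpoly_real:
  assumes "\<And>\<gamma> \<delta>. cnj (c \<gamma> \<delta>) = c \<delta> \<gamma>"
  shows "hpoly c k z = of_real (Re (hpoly c k z))"
proof -
  have "cnj (hpoly c k z) = (\<Sum>\<gamma>\<in>midx k. \<Sum>\<delta>\<in>midx k. c \<delta> \<gamma> * cmono z \<gamma> * cnj (cmono z \<delta>))"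
    by (simp add: hpoly_def assms)
  also have "\<dots> = hpoly c k z"
    unfolding hpoly_def by (subst sum.swap) (simp add: mult_ac)
  finally show ?thesis by (simp add: complex_eq_iff)
qed

text \<open>Expanding the polynomial shifts the exponents exactly as in \<open>locmat\<close>. The
  free weight \<open>h\<close> allows iteration, with \<open>h\<close> a power of the polynomial
  itself.\<close>

lemma integral_hpoly_mult_cmono:
  assumes "\<And>\<alpha> \<beta>. integrable \<mu> (\<lambda>z. h z * (cnj (cmono z \<alpha>) * cmono z \<beta>))"
  shows "(\<integral>z. hpoly c k z * (h z * (cnj (cmono z \<alpha>) * cmono z \<beta>)) \<partial>\<mu>) =
    locmat c k (\<lambda>\<alpha> \<beta>. \<integral>z. h z * (cnj (cmono z \<alpha>) * cmono z \<beta>) \<partial>\<mu>) \<alpha> \<beta>"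
    and "integrable \<mu> (\<lambda>z. hpoly c k z * (h z * (cnj (cmono z \<alpha>) * cmono z \<beta>)))"
proof -
  have eq: "hpoly c k z * (h z * (cnj (cmono z \<alpha>) * cmono z \<beta>)) = (\<Sum>\<gamma>\<in>midx k. \<Sum>\<delta>\<in>midx k.
      c \<gamma> \<delta> * (h z * (cnj (cmono z (mi_add \<alpha> \<gamma>)) * cmono z (mi_add \<beta> \<delta>))))" for z
    by (simp add: hpoly_def cmono_mi_add sum_distrib_left sum_distrib_right mult_ac)
  note [simp] = assms
  show "integrable \<mu> (\<lambda>z. hpoly c k z * (h z * (cnj (cmono z \<alpha>) * cmono z \<beta>)))"
    unfolding eq by (intro Bochner_Integration.integrable_sum integrable_mult_right assms)
  show "(\<integral>z. hpoly c k z * (h z * (cnj (cmono z \<alpha>) * cmono z \<beta>)) \<partial>\<mu>) =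
    locmat c k (\<lambda>\<alpha> \<beta>. \<integral>z. h z * (cnj (cmono z \<alpha>) * cmono z \<beta>) \<partial>\<mu>) \<alpha> \<beta>"
    unfolding eq locmat_def by simp
qed

text \<open>The quadratic form at v is the integral of g |p|^2, where p is the polynomial in z with
  coefficients v and g is real by the symmetry of c.\<close>

lemma psd_on_locmat_of_measure:
  fixes y :: "('n::finite \<Rightarrow> nat) \<Rightarrow> ('n \<Rightarrow> nat) \<Rightarrow> complex"
  assumes int: "\<And>\<alpha> \<beta>. integrable \<mu> (\<lambda>z. cnj (cmono z \<alpha>) * cmono z \<beta>)"
    and y: "\<And>\<alpha> \<beta>. y \<alpha> \<beta> = (\<integral>z. cnj (cmono z \<alpha>) * cmono z \<beta> \<partial>\<mu>)"
    and c: "\<And>\<gamma> \<delta>. cnj (c \<gamma> \<delta>) = c \<delta> \<gamma>"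
    and pos: "AE z in \<mu>. 0 \<le> Re (hpoly c k z)"
  shows "psd_on d (locmat c k y)"
  unfolding psd_on_def Let_def
proof
  fix v :: "('n \<Rightarrow> nat) \<Rightarrow> complex"
  define p where "p z = (\<Sum>\<beta>\<in>midx d. v \<beta> * cmono z \<beta>)" for z
  define H where "H \<alpha> \<beta> z = hpoly c k z * (cnj (cmono z \<alpha>) * cmono z \<beta>)" for \<alpha> \<beta> z
  have L: "locmat c k y \<alpha> \<beta> = (\<integral>z. H \<alpha> \<beta> z \<partial>\<mu>)" for \<alpha> \<beta>
    using integral_hpoly_mult_cmono(1)[of \<mu> "\<lambda>_. 1" c k \<alpha> \<beta>] int by (simp add: y[abs_def] H_def)
  have [simp]: "integrable \<mu> (H \<alpha> \<beta>)" for \<alpha> \<beta>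
    using integral_hpoly_mult_cmono(2)[of \<mu> "\<lambda>_. 1" c k \<alpha> \<beta>] int by (simp add: H_def[abs_def])
  have "(\<Sum>\<alpha>\<in>midx d. \<Sum>\<beta>\<in>midx d. cnj (v \<alpha>) * locmat c k y \<alpha> \<beta> * v \<beta>) =
    (\<integral>z. (\<Sum>\<alpha>\<in>midx d. \<Sum>\<beta>\<in>midx d. cnj (v \<alpha>) * v \<beta> * H \<alpha> \<beta> z) \<partial>\<mu>)"
    by (simp add: L mult_ac)
  also have "(\<lambda>z. (\<Sum>\<alpha>\<in>midx d. \<Sum>\<beta>\<in>midx d. cnj (v \<alpha>) * v \<beta> * H \<alpha> \<beta> z)) =
    (\<lambda>z. hpoly c k z * (cnj (p z) * p z))"
    by (simp add: p_def H_def fun_eq_iff sum_distrib_left sum_distrib_right mult_ac)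
  also have "\<dots> = (\<lambda>z. complex_of_real (Re (hpoly c k z) * (cmod (p z))\<^sup>2))"
  proof
    fix z
    have "cnj (p z) * p z = complex_of_real ((cmod (p z))\<^sup>2)"
      by (simp only: complex_norm_square mult.commute)
    thus "hpoly c k z * (cnj (p z) * p z) = complex_of_real (Re (hpoly c k z) * (cmod (p z))\<^sup>2)"
      using hpoly_real[of c k z] c by (simp only: of_real_mult)
  qed
  finally have *: "(\<Sum>\<alpha>\<in>midx d. \<Sum>\<beta>\<in>midx d. cnj (v \<alpha>) * locmat c k y \<alpha> \<beta> * v \<beta>) =
      complex_of_real (\<integral>z. Re (hpoly c k z) * (cmod (p z))\<^sup>2 \<partial>\<mu>)"
    by (simp only: integral_complex_of_real)
  have "0 \<le> (\<integral>z. Re (hpoly c k z) * (cmod (p z))\<^sup>2 \<partial>\<mu>)"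
    using pos by (intro integral_nonneg_AE) (auto elim!: eventually_mono)
  thus "Im (\<Sum>\<alpha>\<in>midx d. \<Sum>\<beta>\<in>midx d. cnj (v \<alpha>) * locmat c k y \<alpha> \<beta> * v \<beta>) = 0 \<and>
      0 \<le> Re (\<Sum>\<alpha>\<in>midx d. \<Sum>\<beta>\<in>midx d. cnj (v \<alpha>) * locmat c k y \<alpha> \<beta> * v \<beta>)"
    unfolding * by simp
qed

lemma cnj_locmat:
  assumes "\<And>\<gamma> \<delta>. cnj (c \<gamma> \<delta>) = c \<delta> \<gamma>" "\<And>\<alpha> \<beta>. cnj (y \<alpha> \<beta>) = y \<beta> \<alpha>"
  shows "cnj (locmat c k y \<alpha> \<beta>) = locmat c k y \<beta> \<alpha>"
  unfolding locmat_def by (subst (2) sum.swap) (simp add: assms)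

text \<open>A finite index set lies in \<open>midx d\<close> for d the sum of its degrees, and a
  vector on it extends by zero.\<close>

lemma herm_psd_of_psd_on:
  fixes M :: "('n::finite \<Rightarrow> nat) \<Rightarrow> ('n \<Rightarrow> nat) \<Rightarrow> complex"
  assumes "\<And>\<alpha> \<beta>. cnj (M \<alpha> \<beta>) = M \<beta> \<alpha>" "\<And>d. psd_on d M"
  shows "herm_psd M"
  unfolding herm_psd_def
proof (intro conjI allI impI assms(1))
  fix F :: "('n \<Rightarrow> nat) set" and v :: "('n \<Rightarrow> nat) \<Rightarrow> complex"
  assume F: "finite F"
  define d where "d = (\<Sum>\<alpha>\<in>F. mi_deg \<alpha>)"
  have Fd: "F \<subseteq> midx d"
    using F by (auto simp: midx_def d_def intro!: member_le_sum)
  define u where "u \<alpha> = (if \<alpha> \<in> F then v \<alpha> else 0)" for \<alpha>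
  have eq: "(\<Sum>\<alpha>\<in>midx d. \<Sum>\<beta>\<in>midx d. cnj (u \<alpha>) * M \<alpha> \<beta> * u \<beta>) = (\<Sum>\<alpha>\<in>F. \<Sum>\<beta>\<in>F. cnj (v \<alpha>) * M \<alpha> \<beta> * v \<beta>)"
    using Fd by (intro sum.mono_neutral_cong_right finite_midx) (auto simp: u_def)
  show "0 \<le> Re (\<Sum>\<alpha>\<in>F. \<Sum>\<beta>\<in>F. cnj (v \<alpha>) * M \<alpha> \<beta> * v \<beta>)"
    using assms(2)[of d, unfolded psd_on_def Let_def, THEN spec, of u] unfolding eq by (rule conjunct2)
qed

text \<open>The coefficients are diagonal and supported on 0 and the unit multi-indices; k at least
  1 guarantees that the latter are summed over.\<close>

lemma locmat_sphere_coeff: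
  fixes y :: "('n::finite \<Rightarrow> nat) \<Rightarrow> ('n \<Rightarrow> nat) \<Rightarrow> complex"
  assumes k: "1 \<le> k"
  shows "locmat (sphere_coeff R) k y \<alpha> \<beta> =
    complex_of_real (R\<^sup>2) * y \<alpha> \<beta> - (\<Sum>j\<in>UNIV. y (binc j \<alpha>) (binc j \<beta>))"
proof -
  define e where "e j = (\<lambda>l. if l = j then 1 else 0 :: nat)" for j :: 'n
  have inj: "inj e" by (rule injI) (metis e_def zero_neq_one)
  have e0: "e j \<noteq> (\<lambda>_. 0)" for j by (auto simp: e_def fun_eq_iff)
  have mem: "(\<lambda>_. 0) \<in> (midx k :: ('n \<Rightarrow> nat) set)" "e j \<in> midx k" for j
    using k by (auto simp: midx_def mi_deg_def e_def)
  define h where "h \<gamma> = sphere_coeff R \<gamma> \<gamma> * y (mi_add \<alpha> \<gamma>) (mi_add \<beta> \<gamma>)" for \<gamma>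
  have "locmat (sphere_coeff R) k y \<alpha> \<beta> = (\<Sum>\<gamma>\<in>midx k. \<Sum>\<delta>\<in>midx k. if \<delta> = \<gamma> then h \<gamma> else 0)"
    unfolding locmat_def by (intro sum.cong refl) (auto simp: sphere_coeff_def h_def)
  also have "\<dots> = (\<Sum>\<gamma>\<in>midx k. h \<gamma>)" by (simp add: finite_midx)
  also have "\<dots> = (\<Sum>\<gamma>\<in>insert (\<lambda>_. 0) (range e). h \<gamma>)"
    using mem by (intro sum.mono_neutral_right finite_midx) (auto simp: h_def sphere_coeff_def e_def)
  also have "\<dots> = h (\<lambda>_. 0) + (\<Sum>j\<in>UNIV. h (e j))"
    using e0[symmetric] by (subst sum.insert) (auto simp: sum.reindex[OF inj])
  also have "h (\<lambda>_. 0) = complex_of_real (R\<^sup>2) * y \<alpha> \<beta>"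
    by (simp add: h_def sphere_coeff_def mi_add_def)
  also have "(\<Sum>j\<in>UNIV. h (e j)) = (\<Sum>j\<in>UNIV. - y (binc j \<alpha>) (binc j \<beta>))"
  proof (rule sum.cong[OF refl])
    fix j
    have "mi_add \<gamma> (e j) = binc j \<gamma>" for \<gamma> by (auto simp: mi_add_def e_def binc_def)
    moreover have "sphere_coeff R (e j) (e j) = -1"
      using e0 by (auto simp: sphere_coeff_def e_def[abs_def])
    ultimately show "h (e j) = - y (binc j \<alpha>) (binc j \<beta>)" by (simp add: h_def)
  qed
  finally show ?thesis by (simp add: sum_negf)
qed

text \<open>The sphere relation is linear in y and holds at every pair of exponents, so it passes to
  finite combinations of shifts. Hence each localized sequence has a measure of its own.\<close>

lemma locmat_spherical:
  assumes y: "y \<in> spherical_moments R" and psd: "herm_psd (locmat c k y)"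
  shows "locmat c k y \<in> spherical_moments R"
proof -
  have sph: "(\<Sum>j\<in>UNIV. y (binc j \<alpha>) (binc j \<beta>)) = complex_of_real (R\<^sup>2) * y \<alpha> \<beta>" for \<alpha> \<beta>
    using y by (simp add: spherical_moments_def)
  have shift: "mi_add (binc j \<alpha>) \<gamma> = binc j (mi_add \<alpha> \<gamma>)" for j \<alpha> \<gamma>
    by (auto simp: mi_add_def binc_def)
  have "(\<Sum>j\<in>UNIV. locmat c k y (binc j \<alpha>) (binc j \<beta>)) =
        (\<Sum>\<gamma>\<in>midx k. \<Sum>\<delta>\<in>midx k. \<Sum>j\<in>UNIV. c \<gamma> \<delta> * y (binc j (mi_add \<alpha> \<gamma>)) (binc j (mi_add \<beta> \<delta>)))" for \<alpha> \<beta>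
    unfolding locmat_def shift by (subst sum.swap, intro sum.cong refl, rule sum.swap)
  also have "\<dots> \<alpha> \<beta> = complex_of_real (R\<^sup>2) * locmat c k y \<alpha> \<beta>" for \<alpha> \<beta>
    by (simp add: locmat_def sum_distrib_left[symmetric] sph) (simp add: sum_distrib_left mult_ac)
  finally show ?thesis using psd by (simp add: spherical_moments_def)
qed

text \<open>If g times \<open>\<mu>\<close> agrees with \<open>\<mu>'\<close> on monomials, then the \<open>\<mu>\<close>-integral of g q(g) is the
  \<open>\<mu>'\<close>-integral of q(g) for every real polynomial q in one variable. Letting q approximate
  max(0, -t) shows that the \<open>\<mu>\<close>-integral of max(0, -g)^2 is at most 0.\<close>

lemma localizing_measure_imp_support:
  fixes \<mu> \<mu>' :: "(complex ^ 'n::finite) measure"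
  assumes \<mu>: "sets \<mu> = sets borel" "finite_measure \<mu>" "AE z in \<mu>. z \<in> cball 0 B"
    and \<mu>': "sets \<mu>' = sets borel" "finite_measure \<mu>'" "AE z in \<mu>'. z \<in> cball 0 B"
    and c: "\<And>\<gamma> \<delta>. cnj (c \<gamma> \<delta>) = c \<delta> \<gamma>"
    and mom: "\<And>\<alpha> \<beta>. (\<integral>z. cnj (cmono z \<alpha>) * cmono z \<beta> \<partial>\<mu>') =
      locmat c k (\<lambda>\<alpha> \<beta>. \<integral>z. cnj (cmono z \<alpha>) * cmono z \<beta> \<partial>\<mu>) \<alpha> \<beta>"
  shows "AE z in \<mu>. 0 \<le> Re (hpoly c k z)"
proof -
  interpret \<mu>: finite_measure \<mu> by fact
  interpret \<mu>': finite_measure \<mu>' by fact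
  define g where "g = hpoly c k"
  define G where "G z = Re (g z)" for z
  have gG: "g z = of_real (G z)" for z
    unfolding G_def g_def by (rule hpoly_real) (rule c)
  have gc: "continuous_on UNIV g" unfolding g_def by (rule continuous_on_hpoly)
  hence Gc: "continuous_on UNIV G" unfolding G_def by (intro continuous_intros)
  note integ = integrable_continuous_AE_compact[OF \<mu>(1,2) compact_cball \<mu>(3)]
  note integ' = integrable_continuous_AE_compact[OF \<mu>'(1,2) compact_cball \<mu>'(3)]
  define m where "m \<alpha> \<beta> z = cnj (cmono z \<alpha>) * cmono z \<beta>" for \<alpha> \<beta> :: "'n \<Rightarrow> nat" and z :: "complex ^ 'n"
  \<comment> \<open>In the induction step one factor g is expanded into monomials, the hypothesis is
    applied to each shifted monomial, and the factor is reassembled under \<mu>'. This is why the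
    exponents are left general.\<close>
  have powers: "(\<integral>z. g z * (g z ^ l * m \<alpha> \<beta> z) \<partial>\<mu>) = (\<integral>z. g z ^ l * m \<alpha> \<beta> z \<partial>\<mu>')" for l \<alpha> \<beta>
  proof (induction l arbitrary: \<alpha> \<beta>)
    case 0
    have "(\<integral>z. g z * (1 * m \<alpha> \<beta> z) \<partial>\<mu>) = locmat c k (\<lambda>\<alpha> \<beta>. \<integral>z. 1 * m \<alpha> \<beta> z \<partial>\<mu>) \<alpha> \<beta>"
      unfolding g_def m_def by (rule integral_hpoly_mult_cmono(1)) (intro integ continuous_intros)
    thus ?case by (simp add: mom m_def)
  next
    case (Suc l)
    have "(\<integral>z. g z * (g z ^ Suc l * m \<alpha> \<beta> z) \<partial>\<mu>) = (\<integral>z. g z * ((g z * g z ^ l) * m \<alpha> \<beta> z) \<partial>\<mu>)"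
      by simp
    also have "\<dots> = locmat c k (\<lambda>\<alpha> \<beta>. \<integral>z. (g z * g z ^ l) * m \<alpha> \<beta> z \<partial>\<mu>) \<alpha> \<beta>"
      unfolding m_def by (subst g_def, rule integral_hpoly_mult_cmono(1)) (intro integ continuous_intros gc)
    also have "\<dots> = locmat c k (\<lambda>\<alpha> \<beta>. \<integral>z. g z ^ l * m \<alpha> \<beta> z \<partial>\<mu>') \<alpha> \<beta>"
      using Suc.IH by (simp only: mult.assoc)
    also have "\<dots> = (\<integral>z. g z * (g z ^ l * m \<alpha> \<beta> z) \<partial>\<mu>')"
      unfolding m_def by (subst (2) g_def, rule integral_hpoly_mult_cmono(1)[symmetric]) (intro integ' continuous_intros gc)
    finally show ?case by (simp add: mult.assoc)
  qed
  have powers_real: "(\<integral>z. G z * G z ^ l \<partial>\<mu>) = (\<integral>z. G z ^ l \<partial>\<mu>')" for l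
  proof -
    have "complex_of_real (\<integral>z. G z * G z ^ l \<partial>\<mu>) = complex_of_real (\<integral>z. G z ^ l \<partial>\<mu>')"
      using powers[of l "\<lambda>_. 0" "\<lambda>_. 0"]
      by (simp only: integral_complex_of_real[symmetric] m_def cmono_0 gG of_real_mult of_real_power
          complex_cnj_one mult_1_right)
    thus ?thesis by (simp only: of_real_eq_iff)
  qed
  have poly: "(\<integral>z. G z * q (G z) \<partial>\<mu>) = (\<integral>z. q (G z) \<partial>\<mu>')" if q: "real_polynomial_function q" for q
  proof -
    obtain a N where q: "q = (\<lambda>x. \<Sum>i\<le>N. a i * x ^ i)"
      using q by (auto simp: real_polynomial_function_iff_sum)
    have [simp]: "integrable \<mu> (\<lambda>z. G z * G z ^ i)" "integrable \<mu>' (\<lambda>z. G z ^ i)" for i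
      by (intro integ integ' continuous_intros Gc)+
    have "(\<integral>z. G z * q (G z) \<partial>\<mu>) = (\<integral>z. (\<Sum>i\<le>N. a i * (G z * G z ^ i)) \<partial>\<mu>)"
      by (simp only: q sum_distrib_left mult.left_commute)
    also have "\<dots> = (\<Sum>i\<le>N. a i * (\<integral>z. G z * G z ^ i \<partial>\<mu>))"
      by (subst Bochner_Integration.integral_sum) (auto intro: integrable_mult_right)
    also have "\<dots> = (\<Sum>i\<le>N. a i * (\<integral>z. G z ^ i \<partial>\<mu>'))"
      by (simp only: powers_real)
    also have "\<dots> = (\<integral>z. q (G z) \<partial>\<mu>')"
      unfolding q by (subst Bochner_Integration.integral_sum) (auto intro: integrable_mult_right)
    finally show ?thesis .
  qed
  have "bounded (G ` cball 0 B)"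
    by (intro compact_imp_bounded compact_continuous_image continuous_on_subset[OF Gc]) auto
  then obtain M where "\<forall>t\<in>G ` cball 0 B. norm t \<le> M" unfolding bounded_iff by blast
  hence M: "\<bar>G z\<bar> \<le> M" if "z \<in> cball 0 B" for z using that by simp
  define h where "h t = max 0 (- t)" for t :: real
  have hc: "continuous_on S (\<lambda>z. h (f z))" if "continuous_on S f" for S and f :: "complex ^ 'n \<Rightarrow> real"
    unfolding h_def by (intro continuous_intros that)
  have hGG: "G z * h (G z) = - (h (G z))\<^sup>2" for z
    by (auto simp: h_def max_def power2_eq_square)
  \<comment> \<open>\<open>C\<close> gathers the two errors per unit of e: q is at least h - e,
    hence at least -e, on the \<mu>' side, while on the \<mu> side exchanging q for h costs at most
    |M| e pointwise.\<close>
  define C where "C = measure \<mu>' (space \<mu>') + \<bar>M\<bar> * measure \<mu> (space \<mu>)"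
  have lower: "- (e * C) \<le> (\<integral>z. G z * h (G z) \<partial>\<mu>)" if e: "0 < e" for e
  proof -
    have "continuous_on {-M..M} h" unfolding h_def by (intro continuous_intros)
    then obtain q where q: "real_polynomial_function q" and qh: "\<And>t. t \<in> {-M..M} \<Longrightarrow> \<bar>h t - q t\<bar> < e"
      using Stone_Weierstrass_real_polynomial_function[OF compact_Icc _ e] by metis
    have qc: "continuous_on UNIV (\<lambda>z. q (G z))"
      using q real_polynomial_function_eq by (intro continuous_on_compose2[OF continuous_on_polymonial_function[of q UNIV] Gc]) auto
    have GM: "G z \<in> {-M..M}" if "z \<in> cball 0 B" for z using M[OF that] by auto
    have "- (e * measure \<mu>' (space \<mu>')) = (\<integral>z. - e \<partial>\<mu>')" by simp
    also have "\<dots> \<le> (\<integral>z. q (G z) \<partial>\<mu>')"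
    proof (rule integral_mono_AE)
      show "AE z in \<mu>'. - e \<le> q (G z)"
        using \<mu>'(3)
      proof eventually_elim
        case (elim z)
        have "0 \<le> h (G z)" by (simp add: h_def)
        thus ?case using qh[OF GM[OF elim]] by linarith
      qed
    qed (simp, intro integ' qc)
    also have "\<dots> = (\<integral>z. G z * q (G z) \<partial>\<mu>)" using poly[OF q] by simp
    also have "\<dots> \<le> (\<integral>z. G z * h (G z) + \<bar>M\<bar> * e \<partial>\<mu>)"
    proof (rule integral_mono_AE)
      show "AE z in \<mu>. G z * q (G z) \<le> G z * h (G z) + \<bar>M\<bar> * e"
        using \<mu>(3)
      proof eventually_elim
        case (elim z)
        have "G z * (q (G z) - h (G z)) \<le> \<bar>G z\<bar> * \<bar>q (G z) - h (G z)\<bar>"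
          by (metis abs_ge_self abs_mult)
        also have "\<dots> \<le> \<bar>M\<bar> * e"
          using M[OF elim] qh[OF GM[OF elim]] e by (intro mult_mono) auto
        finally show ?case by (simp add: algebra_simps)
      qed
    qed (intro integ continuous_intros qc hc Gc)+
    also have "\<dots> = (\<integral>z. G z * h (G z) \<partial>\<mu>) + \<bar>M\<bar> * e * measure \<mu> (space \<mu>)"
      by (subst Bochner_Integration.integral_add) (auto intro!: integ continuous_intros hc Gc)
    finally show ?thesis by (simp add: C_def algebra_simps)
  qed
  have "0 \<le> (\<integral>z. G z * h (G z) \<partial>\<mu>)"
  proof (rule tendsto_lowerbound)
    have "((\<lambda>e. (\<integral>z. G z * h (G z) \<partial>\<mu>) + e * C) \<longlongrightarrow> (\<integral>z. G z * h (G z) \<partial>\<mu>) + 0 * C) (at_right 0)"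
      by (intro tendsto_intros)
    thus "((\<lambda>e. (\<integral>z. G z * h (G z) \<partial>\<mu>) + e * C) \<longlongrightarrow> (\<integral>z. G z * h (G z) \<partial>\<mu>)) (at_right 0)"
      by simp
    show "\<forall>\<^sub>F e in at_right 0. 0 \<le> (\<integral>z. G z * h (G z) \<partial>\<mu>) + e * C"
      using eventually_at_right_less[of "0::real"] by eventually_elim (use lower in force)
  qed simp
  hence "(\<integral>z. (h (G z))\<^sup>2 \<partial>\<mu>) \<le> 0" by (simp add: hGG)
  moreover have "0 \<le> (\<integral>z. (h (G z))\<^sup>2 \<partial>\<mu>)" by (intro integral_nonneg_AE) auto
  ultimately have "(\<integral>z. (h (G z))\<^sup>2 \<partial>\<mu>) = 0" by simp
  hence "AE z in \<mu>. (h (G z))\<^sup>2 = 0"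
    by (subst (asm) integral_nonneg_eq_0_iff_AE) (auto intro!: integ continuous_intros hc Gc)
  thus ?thesis
    by eventually_elim (simp add: h_def max_def G_def g_def split: if_splits)
qed

section \<open>The equivalence for constraints containing a sphere\<close>

theorem mainTheorem9:
  fixes m :: nat and R :: real
    and g :: "nat \<Rightarrow> ('n::finite \<Rightarrow> nat) \<Rightarrow> ('n \<Rightarrow> nat) \<Rightarrow> complex"
    and k :: "nat \<Rightarrow> nat"
    and y :: "('n \<Rightarrow> nat) \<Rightarrow> ('n \<Rightarrow> nat) \<Rightarrow> complex"
  assumes m_pos: "m \<ge> 1"
    and herm_g: "\<forall>i\<in>{1..m}. \<forall>\<gamma> \<delta>. cnj (g i \<gamma> \<delta>) = g i \<delta> \<gamma>"
    and g0: "g 0 = (\<lambda>\<gamma> \<delta>. if \<gamma> = (\<lambda>_. 0) \<and> \<delta> = (\<lambda>_. 0) then 1 else 0)"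
    and k0: "k 0 = 0"
    and R_pos: "R > 0"
    and sphere: "\<exists>i\<in>{1..m}. \<exists>j\<in>{1..m}. k i \<ge> 1 \<and> k j \<ge> 1 \<and>
                   (\<forall>\<gamma> \<delta>. g i \<gamma> \<delta> = sphere_coeff R \<gamma> \<delta>) \<and>
                   (\<forall>\<gamma> \<delta>. g j \<gamma> \<delta> = - sphere_coeff R \<gamma> \<delta>)"
    and herm_y: "\<forall>\<alpha> \<beta>. cnj (y \<alpha> \<beta>) = y \<beta> \<alpha>"
  shows "has_rep_measure {z. \<forall>i\<in>{1..m}. 0 \<le> Re (hpoly (g i) (k i) z)} y
     \<longleftrightarrow> (\<forall>i\<in>{0..m}. \<forall>d. psd_on d (locmat (g i) (k i) y))"
proof -
  define K where "K = {z. \<forall>i\<in>{1..m}. 0 \<le> Re (hpoly (g i) (k i) z)}"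
  have midx0: "midx 0 = {\<lambda>_. 0 :: nat}"
    by (auto simp: midx_def mi_deg_def)
  have herm: "cnj (g i \<gamma> \<delta>) = g i \<delta> \<gamma>" if "i \<in> {0..m}" for i \<gamma> \<delta>
    using herm_g that by (cases "i = 0") (auto simp: g0)
  have hpoly0: "hpoly (g 0) (k 0) z = 1" for z
    by (simp add: hpoly_def k0 midx0 g0 cmono_0)
  have locmat0: "locmat (g 0) (k 0) y = y"
    by (simp add: locmat_def k0 midx0 g0 mi_add_def fun_eq_iff)
  have "closed ((\<lambda>z. Re (hpoly (g i) (k i) z)) -` {0..})" for i
    by (intro closed_vimage closed_atLeast continuous_on_Re continuous_on_hpoly)
  hence "closed (\<Inter>i\<in>{1..m}. (\<lambda>z. Re (hpoly (g i) (k i) z)) -` {0..})"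
    by (intro closed_INT) auto
  also have "(\<Inter>i\<in>{1..m}. (\<lambda>z. Re (hpoly (g i) (k i) z)) -` {0..}) = K"
    by (auto simp: K_def)
  finally have K: "UNIV - K \<in> sets borel" by auto
  show ?thesis
    unfolding K_def[symmetric]
  proof
    assume "has_rep_measure K y"
    then obtain \<mu> :: "(complex ^ 'n) measure" where \<mu>: "sets \<mu> = sets borel" "emeasure \<mu> (UNIV - K) = 0"
      "\<And>\<alpha> \<beta>. integrable \<mu> (\<lambda>z. cnj (cmono z \<alpha>) * cmono z \<beta>)"
      "\<And>\<alpha> \<beta>. y \<alpha> \<beta> = (\<integral>z. cnj (cmono z \<alpha>) * cmono z \<beta> \<partial>\<mu>)"
      unfolding has_rep_measure_def by blast
    have "AE z in \<mu>. z \<in> K"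
      using K \<mu>(1,2) by (intro AE_I[of _ _ "UNIV - K"]) auto
    hence pos: "AE z in \<mu>. 0 \<le> Re (hpoly (g i) (k i) z)" if "i \<in> {0..m}" for i
      using that by (cases "i = 0") (auto simp: hpoly0 K_def elim!: eventually_mono)
    show "\<forall>i\<in>{0..m}. \<forall>d. psd_on d (locmat (g i) (k i) y)"
    proof (intro ballI allI)
      fix i d assume i: "i \<in> {0..m}"
      show "psd_on d (locmat (g i) (k i) y)"
        by (rule psd_on_locmat_of_measure[OF \<mu>(3,4) herm[OF i] pos[OF i]])
    qed
  next
    assume psd: "\<forall>i\<in>{0..m}. \<forall>d. psd_on d (locmat (g i) (k i) y)"
    have L: "herm_psd (locmat (g i) (k i) y)" if "i \<in> {0..m}" for i
      using psd that herm herm_y by (intro herm_psd_of_psd_on cnj_locmat) auto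
    obtain i j where ij: "i \<in> {1..m}" "j \<in> {1..m}" "1 \<le> k i" "1 \<le> k j"
      "g i = sphere_coeff R" "g j = (\<lambda>\<gamma> \<delta>. - sphere_coeff R \<gamma> \<delta>)"
      using sphere by (auto simp: fun_eq_iff)
    \<comment> \<open>The localizing kernel of the first sphere constraint. The opposite constraint
      makes -N positive semidefinite too, which forces N = 0: this is where the two inequalities
      become the sphere relation.\<close>
    define N where "N \<alpha> \<beta> = complex_of_real (R\<^sup>2) * y \<alpha> \<beta> - (\<Sum>l\<in>UNIV. y (binc l \<alpha>) (binc l \<beta>))" for \<alpha> \<beta>
    have Ni: "locmat (g i) (k i) y = N"
      unfolding ij(5) by (intro ext) (simp only: locmat_sphere_coeff[OF ij(3)] N_def)
    have Nj: "locmat (g j) (k j) y = (\<lambda>\<alpha> \<beta>. - N \<alpha> \<beta>)"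
    proof (intro ext)
      fix \<alpha> \<beta>
      have "locmat (g j) (k j) y \<alpha> \<beta> = - locmat (sphere_coeff R) (k j) y \<alpha> \<beta>"
        by (simp add: locmat_def ij(6) sum_negf)
      thus "locmat (g j) (k j) y \<alpha> \<beta> = - N \<alpha> \<beta>"
        by (simp only: N_def locmat_sphere_coeff[OF ij(4)])
    qed
    have "herm_psd N" "herm_psd (\<lambda>\<alpha> \<beta>. - N \<alpha> \<beta>)"
      using L[of i] L[of j] ij(1,2) unfolding Ni Nj by auto
    hence "N \<alpha> \<beta> = 0" for \<alpha> \<beta> by (rule herm_psd_antisym)
    hence y: "y \<in> spherical_moments R"
      using L[of 0] by (auto simp: spherical_moments_def locmat0 N_def)
    obtain \<mu> :: "(complex ^ 'n) measure" where \<mu>: "sets \<mu> = sets borel" "finite_measure \<mu>"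
      "AE z in \<mu>. z \<in> cball 0 (2 * R * CARD('n))"
      "\<And>\<alpha> \<beta>. (\<integral>z. cnj (cmono z \<alpha>) * cmono z \<beta> \<partial>\<mu>) = y \<alpha> \<beta>"
      using spherical_moments_representable[OF y R_pos] by blast
    \<comment> \<open>The measures of y and of g_i y are compared. The range of i includes both
      sphere constraints, so this also places \<mu> on the sphere inside the ball.\<close>
    have "AE z in \<mu>. 0 \<le> Re (hpoly (g i) (k i) z)" if i: "i \<in> {1..m}" for i
    proof -
      have "locmat (g i) (k i) y \<in> spherical_moments R"
        using i by (intro locmat_spherical y L) auto
      then obtain \<mu>' :: "(complex ^ 'n) measure" where \<mu>': "sets \<mu>' = sets borel" "finite_measure \<mu>'"
        "AE z in \<mu>'. z \<in> cball 0 (2 * R * CARD('n))"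
        "\<And>\<alpha> \<beta>. (\<integral>z. cnj (cmono z \<alpha>) * cmono z \<beta> \<partial>\<mu>') = locmat (g i) (k i) y \<alpha> \<beta>"
        using spherical_moments_representable[OF _ R_pos] by blast
      show ?thesis
        using i by (intro localizing_measure_imp_support[OF \<mu>(1-3) \<mu>'(1-3)] herm)
          (auto simp: \<mu>(4) \<mu>'(4))
    qed
    hence "AE z in \<mu>. \<forall>i\<in>{1..m}. 0 \<le> Re (hpoly (g i) (k i) z)"
      by (intro AE_finite_allI) auto
    hence "AE z in \<mu>. z \<notin> UNIV - K" by (simp add: K_def)
    hence "emeasure \<mu> (UNIV - K) = 0"
      using K \<mu>(1) by (subst (asm) AE_iff_measurable[of "UNIV - K"]) (auto simp: sets_eq_imp_space_eq[OF \<mu>(1)])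
    moreover have "integrable \<mu> (\<lambda>z. cnj (cmono z \<alpha>) * cmono z \<beta>)" for \<alpha> \<beta>
      by (intro integrable_continuous_AE_compact[OF \<mu>(1,2) compact_cball \<mu>(3)] continuous_intros)
    ultimately show "has_rep_measure K y"
      unfolding has_rep_measure_def using \<mu> by (intro exI[of _ \<mu>]) auto
  qed
qed

end
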